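(* Let $X$ be a regular ultrametric space with tree of balls $\mathcal{T}(X)$, let $\nu$ be a $\sigma$-additive Borel measure on $X$ for which the measures of all balls are positive (and finite), and let $T$ be a positive pseudodifferential operator on $X$ of the form $$Tf(x)=\int_X T(\sup(x,y))\,(f(x)-f(y))\,d\nu(y).$$ Assume that for fixed $R\in\mathcal{T}(X)$ both series $$\sum_{J>R}T(J)\,\bigl(\nu(J)-\nu(J-1,R)\bigr)\qquad\text{and}\qquad \sum_{I>R}\lambda_I^{-2}\bigl(\nu^{-1}(I-1,R)-\nu^{-1}(I)\bigr)$$ converge, where $$\lambda_I=T(I)\nu(I)+\sum_{J>I}T(J)\bigl(\nu(J)-\nu(J-1,I)\bigr).$$ Let $\phi$ be white noise on $X$ and let $\psi$ be the Gaussian random field with values in $D'(X)$ which is the solution of $T\psi(x)=\phi(x)$. Then $\psi$ is ultrametric Markovian.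
   Context: **Ultrametric Markovianity.** A random field $\psi(x)$ on an ultrametric space $X$ with values in $D'(X)$ is called ultrametric Markovian if the following holds: whenever $I$, $J$ are balls in $X$ with empty intersection, $f,g\in D(X)$ are supported in $I$ and $J$ respectively, and at least one of $f$, $g$ has zero mean (with respect to $\nu$), the random variables $$\Psi_I(f)=\int_I\psi(x)f(x)\,d\nu(x),\qquad \Psi_J(g)=\int_J\psi(x)g(x)\,d\nu(x)$$ (i.e. $\psi(f)$ and $\psi(g)$) are independent. **Space.** An ultrametric space is a metric space $X$ whose distance $|xy|$ satisfies $|xy|\le\max(|xz|,|yz|)$ for all $z$. $X$ is regular if: (1) the set of all balls of nonzero diameter in $X$ is at most countable; (2) for any infinite strictly decreasing sequence of balls the diameters tend to zero; (3) any ball (of nonzero diameter) is a finite union of maximal (proper) subballs. $X$ is taken complete, so that balls are compact. **Tree.** $\mathcal{T}(X)$ is the set of all balls of nonzero diameter in $X$ together with the balls of zero diameter that are maximal subballs of balls of nonzero diameter, ordered by inclusion; it is a directed tree and its elements are called vertices. For a vertex $I$ of nonzero diameter (a non-minimal vertex), $p_I\ge 2$ is the number of its maximal subballs. For $x\ne y$ in $X$, $\sup(x,y)$ is the minimal ball containing $x$ and $y$. For $J>I$, $(J-1,I)$ is the maximal vertex smaller than $J$ and containing (possibly equal to) $I$, i.e. the maximal subball of $J$ containing $I$; $\nu(J-1,I)$ is its measure, and $\nu^{-1}(\cdot)=1/\nu(\cdot)$. Sums over $J>I$ run over the increasing path of balls strictly containing $I$. **Measure and operator.** $0<\nu(I)<\infty$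 for every $I\in\mathcal{T}(X)$. $T(\cdot)$ is a nonnegative function on $\mathcal{T}(X)$. $T$ is positive in the sense that, in addition, $\lambda_I>0$ for all non-minimal $I$, so that $\lambda_I^{-1}$ makes sense. **Wavelets.** For non-minimal $I$, let $V^0_I$ be the space of $\nu$-mean-zero linear combinations of characteristic functions of the maximal subballs of $I$, and $\{\Psi_{Ij}\}_{j=1}^{p_I-1}$ an orthonormal basis of $V_I^0$ in $L^2(X,\nu)$. The family of all $\Psi_{Ij}$ is the system of ultrametric wavelets; $T\Psi_{Ij}=\lambda_I\Psi_{Ij}$. **Test functions and distributions.** $D(X)$ is the space of complex-valued locally constant functions with compact support; it is the linear span of the characteristic functions of the balls in $\mathcal{T}(X)$. $D'(X)$ is the space of linear functionals on $D(X)$ with the weak topology. Random fields are real: they take real values on real test functions. **White noise and solution.** White noise $\phi$ is the generalized Gaussian real-valued mean zero random field on $X$ with $\langle\phi(x)\phi(x')\rangle=\delta(x-x')$, i.e. $\phi(f)$ is linear in $f\in D(X)$, the family of $\phi(f)$, $f$ real, is jointly Gaussian with mean zero, and $\mathbb{E}[\phi(f)\phi(g)]=\int_X fg\,d\nu$. The solution of $T\psi=\phi$ is the field $\psi=T^{-1}\phi=\sum_{I,j}\lambda_I^{-1}d_{Ij}\Psi_{Ij}$ with $d_{Ij}=\int_X\phi(x)\overline{\Psi_{Ij}(x)}\,d\nu(x)$, i.e. $\psi(f)=\sum_{I,j}\lambda_I^{-1}d_{Ij}\int_X\Psi_{Ij}f\,d\nu$ for $f\in D(X)$. It is a mean zero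 Gaussian field with covariation form $\mathbb{E}[\overline{\psi(f)}\psi(g)]=\sum_{I,j}\lambda_I^{-2}\,\overline{\int f\Psi_{Ij}d\nu}\,\int g\Psi_{Ij}d\nu$. *)

theory Defs
  imports "HOL-Probability.Probability"
begin

section \<open>Balls and regular ultrametric spaces\<close>

text \<open>Radius \<open>0\<close> is allowed, so singletons are the balls of zero diameter.\<close>

definition is_ball :: "'a::metric_space set \<Rightarrow> bool"
  where "is_ball B \<longleftrightarrow> (\<exists>x r. 0 \<le> r \<and> B = cball x r)"

definition maximal_subball :: "'a::metric_space set \<Rightarrow> 'a set \<Rightarrow> bool"
  where "maximal_subball K J \<longleftrightarrow>
    is_ball K \<and> K \<subset> J \<and> (\<forall>L. is_ball L \<and> K \<subseteq> L \<and> L \<subset> J \<longrightarrow> L = K)"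

definition regular_ultrametric_space :: "'a::metric_space itself \<Rightarrow> bool"
  where "regular_ultrametric_space _ \<longleftrightarrow>
    (\<forall>x y z :: 'a. dist x y \<le> max (dist x z) (dist y z)) \<and>
    uniform_space_class.complete (UNIV :: 'a set) \<and>
    countable {B :: 'a set. is_ball B \<and> 0 < diameter B} \<and>
    (\<forall>B :: nat \<Rightarrow> 'a set. (\<forall>n. is_ball (B n) \<and> B (Suc n) \<subset> B n) \<longrightarrow>
      (\<lambda>n. diameter (B n)) \<longlonglongrightarrow> 0) \<and>
    (\<forall>J :: 'a set. is_ball J \<and> 0 < diameter J \<longrightarrow>
      (\<exists>S. finite S \<and> (\<forall>K\<in>S. maximal_subball K J) \<and> J = \<Union>S))"


section \<open>The tree of balls\<close>

definition internal_vertices :: "'a::metric_space set set"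
  where "internal_vertices = {I. is_ball I \<and> 0 < diameter I}"

definition vertices :: "'a::metric_space set set"
  where "vertices = internal_vertices \<union>
    {K. is_ball K \<and> diameter K = 0 \<and> (\<exists>J\<in>internal_vertices. maximal_subball K J)}"

definition maximal_subballs :: "'a::metric_space set \<Rightarrow> 'a set set"
  where "maximal_subballs I = {K. maximal_subball K I}"

definition branching :: "'a::metric_space set \<Rightarrow> nat"
  where "branching I = card (maximal_subballs I)"

definition sup_ball :: "'a::metric_space \<Rightarrow> 'a \<Rightarrow> 'a set"
  where "sup_ball x y = (LEAST B. is_ball B \<and> x \<in> B \<and> y \<in> B)"

text \<open>\<open>pred_ball J I\<close> is the vertex written \<open>(J - 1, I)\<close>.\<close>

definition pred_ball :: "'a::metric_space set \<Rightarrow> 'a set \<Rightarrow> 'a set"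
  where "pred_ball J I = (GREATEST K. K \<in> vertices \<and> K \<subset> J \<and> I \<subseteq> K)"

definition vertices_above :: "'a::metric_space set \<Rightarrow> 'a set set"
  where "vertices_above R = {J \<in> vertices. R \<subset> J}"


section \<open>The pseudodifferential operator\<close>

definition pseudodiff ::
    "'a::metric_space measure \<Rightarrow> ('a set \<Rightarrow> real) \<Rightarrow> ('a \<Rightarrow> complex) \<Rightarrow> 'a \<Rightarrow> complex"
  where "pseudodiff \<nu> T f x = (\<integral>y. complex_of_real (T (sup_ball x y)) * (f x - f y) \<partial>\<nu>)"

definition eigval :: "'a::metric_space measure \<Rightarrow> ('a set \<Rightarrow> real) \<Rightarrow> 'a set \<Rightarrow> real"
  where "eigval \<nu> T I = T I * measure \<nu> I +
    (\<Sum>\<^sub>\<infinity>J\<in>vertices_above I. T J * (measure \<nu> J - measure \<nu> (pred_ball J I)))"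


section \<open>Test functions and wavelets\<close>

definition test_functions :: "('a::metric_space \<Rightarrow> complex) set"
  where "test_functions =
    {f. (\<forall>x. \<exists>U. open U \<and> x \<in> U \<and> f constant_on U) \<and> compact (closure {x. f x \<noteq> 0})}"

definition real_test_functions :: "('a::metric_space \<Rightarrow> complex) set"
  where "real_test_functions = {f \<in> test_functions. \<forall>x. f x \<in> \<real>}"

definition wavelet_space :: "'a::metric_space measure \<Rightarrow> 'a set \<Rightarrow> ('a \<Rightarrow> complex) set"
  where "wavelet_space \<nu> I =
    {f. (\<exists>c. f = (\<lambda>x. \<Sum>K\<in>maximal_subballs I. c K * indicator K x)) \<and> (\<integral>x. f x \<partial>\<nu>) = 0}"

definition wavelet_index :: "('a::metric_space set \<times> nat) set"
  where "wavelet_index = (SIGMA I:internal_vertices. {1..branching I - 1})"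

definition wavelet_system ::
    "'a::metric_space measure \<Rightarrow> ('a set \<Rightarrow> nat \<Rightarrow> 'a \<Rightarrow> complex) \<Rightarrow> bool"
  where "wavelet_system \<nu> \<Psi> \<longleftrightarrow> (\<forall>I\<in>internal_vertices.
    (\<forall>j\<in>{1..branching I - 1}. \<Psi> I j \<in> wavelet_space \<nu> I) \<and>
    (\<forall>j\<in>{1..branching I - 1}. \<forall>k\<in>{1..branching I - 1}.
      (\<integral>x. \<Psi> I j x * cnj (\<Psi> I k x) \<partial>\<nu>) = (if j = k then 1 else 0)) \<and>
    (\<forall>f\<in>wavelet_space \<nu> I. \<exists>c. f = (\<lambda>x. \<Sum>j\<in>{1..branching I - 1}. c j * \<Psi> I j x)))"


section \<open>Random fields\<close>

definition distributions :: "(('a::metric_space \<Rightarrow> complex) \<Rightarrow> complex) set"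
  where "distributions = {u. \<forall>f\<in>test_functions. \<forall>g\<in>test_functions. \<forall>a b.
    u (\<lambda>x. a * f x + b * g x) = a * u f + b * u g}"

text \<open>Measurability of all evaluations is measurability for the weak topology.\<close>

definition random_field ::
    "'w measure \<Rightarrow> ('w \<Rightarrow> ('a::metric_space \<Rightarrow> complex) \<Rightarrow> complex) \<Rightarrow> bool"
  where "random_field M \<psi> \<longleftrightarrow>
    (\<forall>\<omega>\<in>space M. \<psi> \<omega> \<in> distributions) \<and>
    (\<forall>f\<in>test_functions. (\<lambda>\<omega>. \<psi> \<omega> f) \<in> borel_measurable M) \<and>
    (\<forall>\<omega>\<in>space M. \<forall>f\<in>real_test_functions. \<psi> \<omega> f \<in> \<real>)"

text \<open>Degenerate (almost surely constant) variables count as Gaussian.\<close>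

definition gaussian_variable :: "'w measure \<Rightarrow> ('w \<Rightarrow> real) \<Rightarrow> bool"
  where "gaussian_variable M X \<longleftrightarrow> X \<in> borel_measurable M \<and>
    ((\<exists>m. AE \<omega> in M. X \<omega> = m) \<or>
     (\<exists>m s. 0 < s \<and> distributed M lborel X (normal_density m s)))"

definition jointly_gaussian :: "'w measure \<Rightarrow> ('i \<Rightarrow> 'w \<Rightarrow> real) \<Rightarrow> 'i set \<Rightarrow> bool"
  where "jointly_gaussian M X A \<longleftrightarrow>
    (\<forall>F c. finite F \<and> F \<subseteq> A \<longrightarrow> gaussian_variable M (\<lambda>\<omega>. \<Sum>i\<in>F. c i * X i \<omega>))"

definition gaussian_field ::
    "'w measure \<Rightarrow> ('w \<Rightarrow> ('a::metric_space \<Rightarrow> complex) \<Rightarrow> complex) \<Rightarrow> bool"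
  where "gaussian_field M \<psi> \<longleftrightarrow> random_field M \<psi> \<and>
    jointly_gaussian M (\<lambda>f \<omega>. Re (\<psi> \<omega> f)) real_test_functions"

definition white_noise ::
    "'w measure \<Rightarrow> 'a::metric_space measure \<Rightarrow> ('w \<Rightarrow> ('a \<Rightarrow> complex) \<Rightarrow> complex) \<Rightarrow> bool"
  where "white_noise M \<nu> \<phi> \<longleftrightarrow> gaussian_field M \<phi> \<and>
    (\<forall>f\<in>real_test_functions. (\<integral>\<omega>. \<phi> \<omega> f \<partial>M) = 0) \<and>
    (\<forall>f\<in>real_test_functions. \<forall>g\<in>real_test_functions.
      (\<integral>\<omega>. \<phi> \<omega> f * \<phi> \<omega> g \<partial>M) = (\<integral>x. f x * g x \<partial>\<nu>))"

text \<open>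
  \<open>field_solution M \<nu> \<Psi> lam A \<phi> \<psi>\<close>: for an operator \<open>A\<close> that is diagonal in the wavelet system
  with eigenvalues \<open>lam\<close>, the field \<open>\<psi>\<close> is the solution \<open>A\<^sup>-\<^sup>1 \<phi>\<close> of \<open>A \<psi> = \<phi>\<close>, that is, the sum
  of \<open>lam I\<^sup>-\<^sup>1 d\<^sub>I\<^sub>j \<Psi> I j\<close> with \<open>d\<^sub>I\<^sub>j = \<phi> (cnj (\<Psi> I j))\<close>. The sum, evaluated at a test function, is
  an unconditional sum in \<open>L\<^sup>2\<close> of the probability space; the nonnegative integral avoids the
  convention that non-integrable functions have integral zero. For \<open>A = pseudodiff \<nu> T\<close> and
  \<open>lam = eigval \<nu> T\<close> the first conjunct is no restriction: it holds as soon as the series defining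
  \<open>eigval\<close> converges, see \<open>pseudodiff_wavelet\<close> below.
\<close>

definition field_solution ::
    "'w measure \<Rightarrow> 'a::metric_space measure \<Rightarrow> ('a set \<Rightarrow> nat \<Rightarrow> 'a \<Rightarrow> complex) \<Rightarrow>
     ('a set \<Rightarrow> real) \<Rightarrow> (('a \<Rightarrow> complex) \<Rightarrow> 'a \<Rightarrow> complex) \<Rightarrow>
     ('w \<Rightarrow> ('a \<Rightarrow> complex) \<Rightarrow> complex) \<Rightarrow> ('w \<Rightarrow> ('a \<Rightarrow> complex) \<Rightarrow> complex) \<Rightarrow> bool"
  where "field_solution M \<nu> \<Psi> lam A \<phi> \<psi> \<longleftrightarrow>
    (\<forall>(I, j)\<in>wavelet_index. A (\<Psi> I j) = (\<lambda>x. complex_of_real (lam I) * \<Psi> I j x)) \<and>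
    (\<forall>f\<in>test_functions.
      ((\<lambda>F. \<integral>\<^sup>+\<omega>. ennreal ((cmod (\<psi> \<omega> f -
            (\<Sum>(I, j)\<in>F. complex_of_real (inverse (lam I)) * \<phi> \<omega> (\<lambda>x. cnj (\<Psi> I j x)) *
              (\<integral>x. \<Psi> I j x * f x \<partial>\<nu>))))\<^sup>2) \<partial>M) \<longlongrightarrow> 0)
        (finite_subsets_at_top wavelet_index))"

definition ultrametric_markovian ::
    "'w measure \<Rightarrow> 'a::metric_space measure \<Rightarrow> ('w \<Rightarrow> ('a \<Rightarrow> complex) \<Rightarrow> complex) \<Rightarrow> bool"
  where "ultrametric_markovian M \<nu> \<psi> \<longleftrightarrow>
    (\<forall>I J f g. is_ball I \<longrightarrow> is_ball J \<longrightarrow> I \<inter> J = {} \<longrightarrow>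
      f \<in> test_functions \<longrightarrow> g \<in> test_functions \<longrightarrow>
      {x. f x \<noteq> 0} \<subseteq> I \<longrightarrow> {x. g x \<noteq> 0} \<subseteq> J \<longrightarrow>
      (\<integral>x. f x \<partial>\<nu>) = 0 \<or> (\<integral>x. g x \<partial>\<nu>) = 0 \<longrightarrow>
      prob_space.indep_var M borel (\<lambda>\<omega>. \<psi> \<omega> f) borel (\<lambda>\<omega>. \<psi> \<omega> g))"


section \<open>The wavelets are eigenfunctions of the operator\<close>

context
  fixes X :: "'a::metric_space itself"
  assumes ru: "regular_ultrametric_space X"
begin

lemmas ru' = ru[unfolded regular_ultrametric_space_def]

lemma dist_ultra: "dist x y \<le> max (dist x z) (dist y z)" for x y z :: 'a
  by (rule ru'[THEN conjunct1, rule_format])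

lemma countable_internal: "countable (internal_vertices :: 'a set set)"
  unfolding internal_vertices_def by (rule ru'[THEN conjunct2, THEN conjunct2, THEN conjunct1])

lemma decreasing_balls:
  fixes B :: "nat \<Rightarrow> 'a set"
  assumes "\<And>n. is_ball (B n)" "\<And>n. B (Suc n) \<subset> B n"
  shows "(\<lambda>n. diameter (B n)) \<longlonglongrightarrow> 0"
  using ru'[THEN conjunct2, THEN conjunct2, THEN conjunct2, THEN conjunct1, rule_format, of B] assms
  by simp

lemma finite_subballs:
  fixes J :: "'a set"
  assumes "J \<in> internal_vertices"
  obtains S where "finite S" "\<forall>K\<in>S. maximal_subball K J" "J = \<Union>S"
  using ru'[THEN conjunct2, THEN conjunct2, THEN conjunct2, THEN conjunct2, rule_format, of J] assms
  unfolding internal_vertices_def by auto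

lemma cball_eq:
  fixes x y :: 'a
  assumes "y \<in> cball x r"
  shows "cball y r = cball x r"
proof -
  have *: "cball a r \<subseteq> cball b r" if "dist a b \<le> r" for a b :: 'a
  proof
    fix z assume "z \<in> cball a r"
    then show "z \<in> cball b r"
      using dist_ultra[of b z a] that by (auto simp: dist_commute)
  qed
  show ?thesis using *[of x y] *[of y x] assms by (auto simp: dist_commute)
qed

lemma is_ball_at:
  fixes B :: "'a set"
  assumes "is_ball B" "x \<in> B"
  obtains r where "0 \<le> r" "B = cball x r"
proof -
  from assms(1) obtain a r where *: "0 \<le> r" "B = cball a r" unfolding is_ball_def by auto
  then have "B = cball x r" using cball_eq[of x a r] assms(2) by simp
  with * show thesis using that by blast
qed

lemma is_ball_linear:
  fixes A B :: "'a set"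
  assumes "is_ball A" "is_ball B" "x \<in> A" "x \<in> B"
  shows "A \<subseteq> B \<or> B \<subseteq> A"
proof -
  from assms(1,3) obtain r where r: "A = cball x r" by (rule is_ball_at)
  from assms(2,4) obtain s where s: "B = cball x s" by (rule is_ball_at)
  show ?thesis unfolding r s by (metis linear subset_cball)
qed

lemma is_ball_sup: "is_ball (cball x (dist x y))" for x y :: 'a
  unfolding is_ball_def using zero_le_dist by blast

lemma sup_ball_eq: "sup_ball x y = cball x (dist x y)" for x y :: 'a
  unfolding sup_ball_def
proof (rule Least_equality)
  fix B :: "'a set" assume B: "is_ball B \<and> x \<in> B \<and> y \<in> B"
  then have "is_ball B" "x \<in> B" by auto
  then obtain r where r: "B = cball x r" by (rule is_ball_at)
  have "dist x y \<le> r" using B unfolding r by simp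
  then show "cball x (dist x y) \<subseteq> B" unfolding r by (rule subset_cball)
qed (use is_ball_sup in auto)

lemma is_ball_internal:
  fixes B :: "'a set"
  assumes "is_ball B" "x \<in> B" "y \<in> B" "x \<noteq> y"
  shows "B \<in> internal_vertices"
proof -
  have "bounded B" using assms(1) unfolding is_ball_def by auto
  then have "dist x y \<le> diameter B" using assms diameter_bounded_bound by blast
  moreover have "0 < dist x y" using assms(4) by simp
  ultimately have "0 < diameter B" by linarith
  then show ?thesis using assms(1) unfolding internal_vertices_def by auto
qed

lemma internal_is_ball: "I \<in> internal_vertices \<Longrightarrow> is_ball I" for I :: "'a set"
  unfolding internal_vertices_def by auto

lemma internal_vertex: "I \<in> internal_vertices \<Longrightarrow> I \<in> vertices" for I :: "'a set"
  unfolding vertices_def by auto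

lemma vertex_is_ball: "I \<in> vertices \<Longrightarrow> is_ball I" for I :: "'a set"
  unfolding vertices_def internal_vertices_def by auto

lemma is_ball_nonempty: "is_ball I \<Longrightarrow> \<exists>x. x \<in> I" for I :: "'a set"
  unfolding is_ball_def using centre_in_cball by blast

lemma maximal_subballD:
  fixes I K :: "'a set"
  assumes "maximal_subball K I"
  shows "is_ball K" "K \<subset> I" "K \<subseteq> I" "\<And>L. is_ball L \<Longrightarrow> K \<subseteq> L \<Longrightarrow> L \<subset> I \<Longrightarrow> L = K"
  using assms unfolding maximal_subball_def by auto

lemma maximal_subball_vertex:
  fixes I K :: "'a set"
  assumes "I \<in> internal_vertices" "maximal_subball K I"
  shows "K \<in> vertices"
proof -
  have b: "is_ball K" using assms(2) unfolding maximal_subball_def by auto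
  then have "bounded K" unfolding is_ball_def by auto
  then have "0 \<le> diameter K" by (rule diameter_ge_0)
  then show ?thesis using assms b unfolding vertices_def internal_vertices_def by fastforce
qed

lemma maximal_subball_ex:
  fixes I :: "'a set"
  assumes "I \<in> internal_vertices" "x \<in> I"
  obtains K where "maximal_subball K I" "x \<in> K"
proof -
  obtain S where "\<forall>K\<in>S. maximal_subball K I" "I = \<Union>S"
    using finite_subballs[OF assms(1)] .
  then show ?thesis using assms(2) that by blast
qed

lemma maximal_subball_unique:
  fixes I :: "'a set"
  assumes "maximal_subball K I" "maximal_subball L I" "x \<in> K" "x \<in> L"
  shows "K = L"
  using is_ball_linear[OF maximal_subballD(1)[OF assms(1)] maximal_subballD(1)[OF assms(2)] assms(3,4)]
    maximal_subballD[OF assms(1)] maximal_subballD[OF assms(2)] by auto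

lemma finite_maximal_subballs:
  fixes I :: "'a set"
  assumes "I \<in> internal_vertices"
  shows "finite (maximal_subballs I)"
proof -
  obtain S where S: "finite S" "\<forall>K\<in>S. maximal_subball K I" "I = \<Union>S"
    using finite_subballs[OF assms] .
  have "maximal_subballs I \<subseteq> S"
  proof
    fix K assume "K \<in> maximal_subballs I"
    then have K: "maximal_subball K I" unfolding maximal_subballs_def by auto
    obtain x where x: "x \<in> K" using is_ball_nonempty[OF maximal_subballD(1)[OF K]] by auto
    then have "x \<in> I" using maximal_subballD(3)[OF K] by auto
    then obtain L where L: "L \<in> S" "x \<in> L" using S(3) by auto
    then have "K = L" using maximal_subball_unique[OF K _ x] S(2) by simp
    with L show "K \<in> S" by simp
  qed
  then show ?thesis using S(1) finite_subset by blast
qed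

lemma sup_ball_maximal:
  fixes I :: "'a set"
  assumes "is_ball I" "maximal_subball K I" "x \<in> K" "y \<in> I" "y \<notin> K"
  shows "sup_ball x y = I"
proof -
  let ?S = "cball x (dist x y)"
  have K: "is_ball K" "K \<subset> I" using assms(2) unfolding maximal_subball_def by auto
  have "x \<in> I" using K assms by auto
  with assms(1) obtain r where r: "I = cball x r" by (rule is_ball_at)
  have "dist x y \<le> r" using assms(4) unfolding r by simp
  then have "?S \<subseteq> I" unfolding r by (rule subset_cball)
  moreover have "K \<subseteq> ?S"
    using is_ball_linear[OF K(1) is_ball_sup assms(3), of x y] assms(5) by auto
  moreover have "y \<in> ?S" by simp
  ultimately have "?S = I"
    using maximal_subballD(4)[OF assms(2) is_ball_sup[of x y]] assms(5) by blast
  then show ?thesis by (simp add: sup_ball_eq)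
qed

lemma pred_ball_eq:
  fixes I J :: "'a set"
  assumes "J \<in> internal_vertices" "maximal_subball K J" "I \<subseteq> K" "x \<in> I"
  shows "pred_ball J I = K"
  unfolding pred_ball_def
proof (rule Greatest_equality)
  show "K \<in> vertices \<and> K \<subset> J \<and> I \<subseteq> K"
    using maximal_subball_vertex[OF assms(1,2)] maximal_subballD(2)[OF assms(2)] assms(3) by simp
next
  fix L assume L: "L \<in> vertices \<and> L \<subset> J \<and> I \<subseteq> L"
  then have b: "is_ball L" using vertex_is_ball by simp
  have "L \<subseteq> K \<or> K \<subseteq> L"
    using is_ball_linear[OF b maximal_subballD(1)[OF assms(2)], of x] L assms(3,4) by auto
  then show "L \<le> K" using maximal_subballD(4)[OF assms(2) b] L by auto
qed

lemma vertices_above_pred: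
  fixes I J :: "'a set"
  assumes "is_ball I" "J \<in> vertices_above I"
  shows "J \<in> internal_vertices \<and> maximal_subball (pred_ball J I) J \<and> I \<subseteq> pred_ball J I"
proof -
  have J: "J \<in> vertices" "I \<subset> J" using assms(2) unfolding vertices_above_def by auto
  obtain x where x: "x \<in> I" using is_ball_nonempty[OF assms(1)] by auto
  obtain y where y: "y \<in> J" "y \<notin> I" using J by blast
  have J': "J \<in> internal_vertices"
    using is_ball_internal[OF vertex_is_ball[OF J(1)], of x y] J x y by auto
  obtain K where K: "maximal_subball K J" "x \<in> K"
    using maximal_subball_ex[OF J', of x] J x by blast
  have "I \<subseteq> K \<or> K \<subseteq> I"
    using is_ball_linear[OF assms(1) maximal_subballD(1)[OF K(1)] x K(2)] .
  then have "I \<subseteq> K" using maximal_subballD(4)[OF K(1) assms(1)] J(2) by auto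
  with pred_ball_eq[OF J' K(1) this x] J' K show ?thesis by simp
qed

text \<open>Only finitely many vertices lie between two given balls.\<close>

lemma finite_between:
  fixes I U :: "'a set"
  assumes I: "I \<in> internal_vertices" and U: "is_ball U"
  shows "finite {J \<in> vertices_above I. J \<subseteq> U}"
proof (rule ccontr)
  define C where "C V = {J \<in> vertices_above I. J \<subseteq> V}" for V
  assume "infinite {J \<in> vertices_above I. J \<subseteq> U}"
  then have inf: "infinite (C U)" unfolding C_def by simp
  obtain x where x: "x \<in> I" using is_ball_nonempty[OF internal_is_ball[OF I]] by auto
  have ib: "is_ball I" using internal_is_ball[OF I] .
  have vb: "is_ball J \<and> I \<subset> J" if "J \<in> C V" for J V
    using that vertex_is_ball[of J] unfolding C_def vertices_above_def by simp
  have step: "\<exists>W. (is_ball W \<and> infinite (C W)) \<and> W \<subset> V" if V: "is_ball V" "infinite (C V)" for V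
  proof -
    obtain J where J: "J \<in> C V" using V(2) by (metis all_not_in_conv finite.emptyI)
    have sub: "I \<subset> V" using vb[OF J] J unfolding C_def by blast
    obtain y where y: "y \<in> V" "y \<notin> I" using sub by blast
    have "V \<in> vertices"
      using internal_vertex[OF is_ball_internal[OF V(1), of x y]] x y sub by auto
    then have Va: "V \<in> vertices_above I" using sub unfolding vertices_above_def by simp
    let ?W = "pred_ball V I"
    have W: "maximal_subball ?W V" "I \<subseteq> ?W" using vertices_above_pred[OF ib Va] by auto
    have bW: "is_ball ?W" "?W \<subset> V" using maximal_subballD[OF W(1)] by auto
    have "C V \<subseteq> insert V (C ?W)"
    proof
      fix L assume L: "L \<in> C V"
      then have "L \<subseteq> ?W \<or> ?W \<subseteq> L"
        using is_ball_linear[OF conjunct1[OF vb[OF L]] bW(1), of x] vb[OF L] x W(2) by auto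
      then have "L = V \<or> L \<subseteq> ?W"
        using maximal_subballD(4)[OF W(1) conjunct1[OF vb[OF L]]] L unfolding C_def by auto
      then show "L \<in> insert V (C ?W)" using L unfolding C_def by blast
    qed
    then have "infinite (C ?W)" using V(2) finite_subset by blast
    with bW show ?thesis by blast
  qed
  obtain B :: "nat \<Rightarrow> 'a set" where
    B: "\<And>n. is_ball (B n) \<and> infinite (C (B n))" "\<And>n. B (Suc n) \<subset> B n"
    using dependent_nat_choice[where P = "\<lambda>_ V. is_ball V \<and> infinite (C V)"
        and Q = "\<lambda>_ V W. W \<subset> V"] inf U step by (metis (no_types, lifting))
  then have lim: "(\<lambda>n. diameter (B n)) \<longlonglongrightarrow> 0"
    by (intro decreasing_balls) auto
  have "diameter I \<le> diameter (B n)" for n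
  proof -
    obtain J where J: "J \<in> C (B n)" using B(1)[of n] by (metis all_not_in_conv finite.emptyI)
    have "bounded (B n)" using B(1)[of n] unfolding is_ball_def by auto
    then show ?thesis using vb[OF J] J unfolding C_def by (intro diameter_subset) auto
  qed
  then have "diameter I \<le> 0"
    using lim by (intro LIMSEQ_le_const) auto
  then show False using I unfolding internal_vertices_def by auto
qed


context
  fixes \<nu> :: "'a measure" and T :: "'a set \<Rightarrow> real" and R :: "'a set"
  assumes borel: "sets \<nu> = sets borel"
    and ball_measure: "\<And>I. I \<in> vertices \<Longrightarrow> 0 < emeasure \<nu> I \<and> emeasure \<nu> I < \<infinity>"
    and T_nonneg: "\<And>I. I \<in> vertices \<Longrightarrow> 0 \<le> T I"
    and R: "R \<in> vertices"
    and convergence: "(\<lambda>J. T J * (measure \<nu> J - measure \<nu> (pred_ball J R))) summable_on vertices_above R"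
begin

lemma summable_vertices_above:
  assumes I: "I \<in> internal_vertices"
  shows "(\<lambda>J. T J * (measure \<nu> J - measure \<nu> (pred_ball J I))) summable_on vertices_above I"
    (is "?f summable_on _")
proof -
  have bI: "is_ball I" and bR: "is_ball R"
    using internal_is_ball[OF I] vertex_is_ball[OF R] by simp_all
  obtain x where x: "x \<in> I" using is_ball_nonempty[OF bI] by auto
  obtain y where y: "y \<in> R" using is_ball_nonempty[OF bR] by auto
  have "bounded (I \<union> R)" using bI bR unfolding is_ball_def by auto
  then obtain e where e: "\<forall>z\<in>I \<union> R. dist x z \<le> e"
    using bounded_any_center[of "I \<union> R" x] by blast
  define r where "r = max 1 e"
  have r: "0 < r" "I \<union> R \<subseteq> cball x r" unfolding r_def using e by (simp, force intro: max.coboundedI2)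
  define U where "U = cball x r"
  have U: "is_ball U" "I \<subseteq> U" "R \<subseteq> U"
    using r unfolding U_def is_ball_def by (auto intro: less_imp_le)
  define A where "A = {J \<in> vertices_above I. J \<subseteq> U}"
  define B where "B = vertices_above I - A"
  have B: "J \<in> vertices_above R \<and> pred_ball J I = pred_ball J R" if J: "J \<in> B" for J
  proof -
    have J': "J \<in> vertices" "I \<subset> J" "\<not> J \<subseteq> U"
      using J unfolding B_def A_def vertices_above_def by auto
    then have UJ: "U \<subset> J"
      using is_ball_linear[OF vertex_is_ball[OF J'(1)] U(1), of x] U x by auto
    then have "J \<in> vertices_above U" using J' unfolding vertices_above_def by blast
    then have *: "J \<in> internal_vertices" "maximal_subball (pred_ball J U) J" "U \<subseteq> pred_ball J U"
      using vertices_above_pred[OF U(1)] by simp_all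
    have "pred_ball J I = pred_ball J U" "pred_ball J R = pred_ball J U"
      using pred_ball_eq[OF *(1,2) _ x] pred_ball_eq[OF *(1,2) _ y] *(3) U(2,3) by auto
    then show ?thesis using UJ U J' unfolding vertices_above_def by auto
  qed
  have "(\<lambda>J. T J * (measure \<nu> J - measure \<nu> (pred_ball J R))) summable_on B"
    using convergence by (rule summable_on_subset_banach) (use B in blast)
  then have "?f summable_on B" by (rule summable_on_cong[THEN iffD1, rotated]) (use B in auto)
  moreover have "?f summable_on A"
    using finite_between[OF I U(1)] unfolding A_def by simp
  ultimately have "?f summable_on (A \<union> B)"
    by (intro summable_on_Un_disjoint) (auto simp: B_def)
  moreover have "A \<union> B = vertices_above I" unfolding B_def A_def by auto
  ultimately show ?thesis by simp
qed

lemma is_ball_measurable: "is_ball J \<Longrightarrow> J \<in> sets \<nu>" for J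
  unfolding is_ball_def borel by auto

lemma outer_integral:
  assumes I: "I \<in> internal_vertices" and x: "x \<in> I"
  defines "h \<equiv> \<lambda>y. if y \<in> I then 0 else T (sup_ball x y)"
  defines "g \<equiv> \<lambda>J. T J * (measure \<nu> J - measure \<nu> (pred_ball J I))"
  shows "has_bochner_integral \<nu> h (\<Sum>\<^sub>\<infinity>J\<in>vertices_above I. g J)"
proof -
  let ?A = "vertices_above I"
  define k where "k y J = ennreal (T J) * indicator (J - pred_ball J I) y" for y J
  have bI: "is_ball I" using internal_is_ball[OF I] .
  have A: "J \<in> vertices" "pred_ball J I \<in> vertices" "pred_ball J I \<subset> J" "I \<subseteq> pred_ball J I"
    "maximal_subball (pred_ball J I) J" "J \<in> internal_vertices" if "J \<in> ?A" for J
    using vertices_above_pred[OF bI that] that maximal_subball_vertex[of J "pred_ball J I"]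
      maximal_subballD(2)[of "pred_ball J I" J]
    unfolding vertices_above_def by auto
  have setA: "J - pred_ball J I \<in> sets \<nu>" if "J \<in> ?A" for J
    using is_ball_measurable[OF vertex_is_ball[OF A(1)[OF that]]]
      is_ball_measurable[OF vertex_is_ball[OF A(2)[OF that]]] by auto
  have "?A \<subseteq> internal_vertices" using A(6) by auto
  then have cA: "countable ?A" using countable_internal countable_subset by blast
  have h_nonneg: "0 \<le> h y" for y
  proof (cases "y \<in> I")
    case False
    then have "sup_ball x y \<in> internal_vertices"
      using is_ball_internal[OF is_ball_sup, of x x y y] x unfolding sup_ball_eq by auto
    then show ?thesis unfolding h_def using T_nonneg internal_vertex by auto
  qed (simp add: h_def)
  have hk: "ennreal (h y) = (\<integral>\<^sup>+J. k y J \<partial>count_space ?A)" for y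
  proof (cases "y \<in> I")
    case True
    then have "(\<integral>\<^sup>+J. k y J \<partial>count_space ?A) = (\<integral>\<^sup>+J. 0 \<partial>count_space ?A)"
      using A(4) by (intro nn_integral_cong) (auto simp: k_def indicator_def)
    then show ?thesis using True by (simp add: h_def)
  next
    case False
    let ?S = "sup_ball x y"
    have S: "?S \<in> vertices" "x \<in> ?S" "y \<in> ?S"
      using is_ball_internal[OF is_ball_sup, of x x y y] x False internal_vertex
      unfolding sup_ball_eq by auto
    then have "I \<subset> ?S"
      using is_ball_linear[OF bI vertex_is_ball[OF S(1)] x S(2)] False by auto
    then have SA: "?S \<in> ?A" using S unfolding vertices_above_def by blast
    have key: "y \<in> J - pred_ball J I \<longleftrightarrow> J = ?S" if J: "J \<in> ?A" for J
    proof
      assume "y \<in> J - pred_ball J I"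
      then show "J = ?S"
        using sup_ball_maximal[OF vertex_is_ball[OF A(1)[OF J]] A(5)[OF J], of x y] A(4)[OF J] x
        by auto
    next
      assume J': "J = ?S"
      have "y \<notin> pred_ball J I"
      proof
        assume y: "y \<in> pred_ball J I"
        have "x \<in> pred_ball J I" using A(4)[OF J] x by auto
        with vertex_is_ball[OF A(2)[OF J]] obtain r where r: "pred_ball J I = cball x r"
          by (rule is_ball_at)
        have "dist x y \<le> r" using y unfolding r by simp
        then have "?S \<subseteq> pred_ball J I" unfolding r sup_ball_eq by (rule subset_cball)
        then show False using A(3)[OF J] J' by blast
      qed
      then show "y \<in> J - pred_ball J I" using J' S by blast
    qed
    have "(\<integral>\<^sup>+J. k y J \<partial>count_space ?A) =
      (\<integral>\<^sup>+J. ennreal (T ?S) * indicator {?S} J \<partial>count_space ?A)"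
      using key by (intro nn_integral_cong) (auto simp: k_def indicator_def)
    also have "\<dots> = ennreal (T ?S)"
      using SA by (subst nn_integral_cmult_indicator) auto
    finally show ?thesis using False by (simp add: h_def)
  qed
  have km: "(\<lambda>y. k y J) \<in> borel_measurable \<nu>" if "J \<in> ?A" for J
    using setA[OF that] unfolding k_def by measurable
  have "(\<lambda>p. k (fst p) (snd p)) \<in> borel_measurable (\<nu> \<Otimes>\<^sub>M count_space ?A)"
    by (rule measurable_compose_countable'[where f = "\<lambda>J p. k (fst p) J" and g = snd, OF _ _ cA])
      (auto intro: measurable_compose[OF measurable_fst km])
  then have "case_prod k \<in> borel_measurable (\<nu> \<Otimes>\<^sub>M count_space ?A)"
    by (simp add: case_prod_beta')
  then have "(\<lambda>y. \<integral>\<^sup>+J. k y J \<partial>count_space ?A) \<in> borel_measurable \<nu>"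
    by (rule sigma_finite_measure.borel_measurable_nn_integral
        [OF sigma_finite_measure_count_space_countable[OF cA]])
  then have "(\<lambda>y. enn2real (ennreal (h y))) \<in> borel_measurable \<nu>"
    unfolding hk by (rule borel_measurable_enn2real)
  then have hm: "h \<in> borel_measurable \<nu>" using h_nonneg by simp
  have g_nonneg: "0 \<le> g J" if "J \<in> ?A" for J
  proof -
    have "J \<in> fmeasurable \<nu>"
      using ball_measure[OF A(1)[OF that]] is_ball_measurable[OF vertex_is_ball[OF A(1)[OF that]]]
      by (simp add: fmeasurable_def)
    then have "measure \<nu> (pred_ball J I) \<le> measure \<nu> J"
      using A(3)[OF that] is_ball_measurable[OF vertex_is_ball[OF A(2)[OF that]]]
      by (intro measure_mono_fmeasurable) auto
    then show ?thesis unfolding g_def using T_nonneg[OF A(1)[OF that]] by simp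
  qed
  have kint: "(\<integral>\<^sup>+y. k y J \<partial>\<nu>) = ennreal (g J)" if J: "J \<in> ?A" for J
  proof -
    have f: "emeasure \<nu> J \<noteq> \<infinity>" "emeasure \<nu> (pred_ball J I) \<noteq> \<infinity>"
      using ball_measure[of J] ball_measure[of "pred_ball J I"] A[OF J] by auto
    have m: "J \<in> sets \<nu>" "pred_ball J I \<in> sets \<nu>"
      using A(1,2)[OF J] is_ball_measurable vertex_is_ball by simp_all
    have sub: "pred_ball J I \<subseteq> J" using A(3)[OF J] by blast
    have "measure \<nu> (J - pred_ball J I) = measure \<nu> J - measure \<nu> (pred_ball J I)"
      using f(1) m sub by (rule measure_Diff)
    moreover have "emeasure \<nu> (J - pred_ball J I) \<le> emeasure \<nu> J"
      using m(1) by (intro emeasure_mono) auto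
    then have "emeasure \<nu> (J - pred_ball J I) \<noteq> \<infinity>"
      using f(1) by (auto simp: top_unique)
    ultimately show ?thesis
      unfolding k_def g_def using setA[OF J] T_nonneg[OF A(1)[OF J]]
      by (simp add: nn_integral_cmult_indicator emeasure_eq_ennreal_measure ennreal_mult')
  qed
  have sm: "g summable_on ?A" unfolding g_def by (rule summable_vertices_above[OF I])
  then have sm': "Infinite_Set_Sum.abs_summable_on g ?A"
    unfolding abs_summable_equivalent[symmetric]
    by (rule summable_on_cong[THEN iffD1, rotated]) (use g_nonneg in auto)
  have "(\<integral>\<^sup>+y. ennreal (h y) \<partial>\<nu>) = (\<integral>\<^sup>+J. \<integral>\<^sup>+y. k y J \<partial>\<nu> \<partial>count_space ?A)"
    unfolding hk by (rule nn_integral_count_space_nn_integral[where f = "\<lambda>J y. k y J", OF cA km])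
  also have "\<dots> = (\<integral>\<^sup>+J. ennreal (g J) \<partial>count_space ?A)"
    using kint by (intro nn_integral_cong) auto
  also have "\<dots> = ennreal (infsetsum g ?A)"
    by (rule nn_integral_conv_infsetsum[OF sm' g_nonneg])
  also have "infsetsum g ?A = infsum g ?A" using sm' by (rule infsetsum_infsum)
  finally have "(\<integral>\<^sup>+y. ennreal (h y) \<partial>\<nu>) = ennreal (infsum g ?A)" .
  moreover have "0 \<le> infsum g ?A" using g_nonneg by (rule infsum_nonneg)
  ultimately show ?thesis
    using hm h_nonneg by (intro has_bochner_integral_nn_integral) auto
qed

lemma pseudodiff_wavelet:
  assumes I: "I \<in> internal_vertices" and f: "f \<in> wavelet_space \<nu> I"
  shows "pseudodiff \<nu> T f = (\<lambda>x. complex_of_real (eigval \<nu> T I) * f x)"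
proof
  fix x
  have bI: "is_ball I" using internal_is_ball[OF I] .
  obtain c where fc: "f = (\<lambda>x. \<Sum>K\<in>maximal_subballs I. c K * indicator K x)"
    and f0: "(\<integral>x. f x \<partial>\<nu>) = 0"
    using f unfolding wavelet_space_def by blast
  have fin: "finite (maximal_subballs I)" using finite_maximal_subballs[OF I] .
  have fK: "f y = c K" if "maximal_subball K I" "y \<in> K" for y K
  proof -
    have "f y = (\<Sum>L\<in>maximal_subballs I. if L = K then c K else 0)"
      unfolding fc using that maximal_subball_unique
      by (intro sum.cong) (auto simp: maximal_subballs_def indicator_def)
    also have "\<dots> = c K" using fin that by (simp add: maximal_subballs_def)
    finally show ?thesis .
  qed
  have out: "f y = 0" if "y \<notin> I" for y
    unfolding fc using that
    by (intro sum.neutral) (auto simp: maximal_subballs_def maximal_subball_def indicator_def)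
  show "pseudodiff \<nu> T f x = complex_of_real (eigval \<nu> T I) * f x"
  proof (cases "x \<in> I")
    case False
    obtain a where a: "a \<in> I" using is_ball_nonempty[OF bI] by auto
    from bI a obtain r where r: "I = cball a r" by (rule is_ball_at)
    have "sup_ball x y = sup_ball x a" if "y \<in> I" for y
    proof -
      have "dist a y \<le> r" "r < dist a x" using that False r by auto
      then have "dist x y = dist x a"
        using dist_ultra[of x y a] dist_ultra[of x a y] by (auto simp: dist_commute max_def split: if_splits)
      then show ?thesis by (simp add: sup_ball_eq)
    qed
    then have "pseudodiff \<nu> T f x = (\<integral>y. - complex_of_real (T (sup_ball x a)) * f y \<partial>\<nu>)"
      unfolding pseudodiff_def using out False by (intro Bochner_Integration.integral_cong) (auto, metis)
    also have "\<dots> = 0" using f0 by simp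
    finally show ?thesis using out False by simp
  next
    case True
    obtain K where K: "maximal_subball K I" "x \<in> K" using maximal_subball_ex[OF I True] .
    define h where "h y = (if y \<in> I then 0 else T (sup_ball x y))" for y
    let ?S = "\<Sum>\<^sub>\<infinity>J\<in>vertices_above I. T J * (measure \<nu> J - measure \<nu> (pred_ball J I))"
    have hb: "has_bochner_integral \<nu> h ?S"
      unfolding h_def by (rule outer_integral[OF I True])
    have ind: "integrable \<nu> (indicator J :: 'a \<Rightarrow> complex)" if "J \<in> vertices" for J
      using ball_measure[OF that] is_ball_measurable[OF vertex_is_ball[OF that]]
      by (intro integrable_real_indicator[THEN integrable_of_real, where 'a = complex, unfolded of_real_indicator]) auto
    have fi: "integrable \<nu> f"
      unfolding fc using ind maximal_subball_vertex[OF I]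
      by (intro Bochner_Integration.integrable_sum integrable_mult_right)
        (auto simp: maximal_subballs_def)
    have Ii: "integrable \<nu> (\<lambda>y. f x * indicator I y)"
      using ind[OF internal_vertex[OF I]] by (intro integrable_mult_right)
    have mI: "(\<integral>y. indicator I y \<partial>\<nu>) = complex_of_real (measure \<nu> I)"
    proof -
      have "I \<inter> space \<nu> = I"
        using is_ball_measurable[OF bI] sets.sets_into_space by blast
      then have "(\<integral>y. complex_of_real (indicator I y) \<partial>\<nu>) = complex_of_real (measure \<nu> I)"
        by (simp add: integral_complex_of_real)
      then show ?thesis by (simp add: of_real_indicator)
    qed
    have "complex_of_real (T (sup_ball x y)) * (f x - f y) =
      complex_of_real (T I) * (f x * indicator I y - f y) + f x * complex_of_real (h y)" for y
    proof (cases "y \<in> K")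
      case True
      then have "y \<in> I" "f y = f x" using K fK unfolding maximal_subball_def by auto
      then show ?thesis by (simp add: h_def)
    next
      case False
      then show ?thesis
        using sup_ball_maximal[OF bI K, of y] out[of y] by (cases "y \<in> I") (auto simp: h_def)
    qed
    then have "pseudodiff \<nu> T f x = (\<integral>y. complex_of_real (T I) * (f x * indicator I y - f y) +
      f x * complex_of_real (h y) \<partial>\<nu>)"
      unfolding pseudodiff_def by simp
    also have "\<dots> = (\<integral>y. complex_of_real (T I) * (f x * indicator I y - f y) \<partial>\<nu>) +
      (\<integral>y. f x * complex_of_real (h y) \<partial>\<nu>)"
      using fi Ii ind[OF internal_vertex[OF I]] hb
      by (intro Bochner_Integration.integral_add integrable_mult_right
          Bochner_Integration.integrable_diff integrable_of_real)
        (auto simp: has_bochner_integral_iff)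
    also have "(\<integral>y. complex_of_real (T I) * (f x * indicator I y - f y) \<partial>\<nu>) =
      complex_of_real (T I) * (f x * complex_of_real (measure \<nu> I))"
      using fi Ii f0 mI by (simp add: Bochner_Integration.integral_diff)
    also have "(\<integral>y. f x * complex_of_real (h y) \<partial>\<nu>) = f x * complex_of_real ?S"
      using hb by (simp add: has_bochner_integral_iff)
    finally show ?thesis by (simp add: eigval_def algebra_simps)
  qed
qed

end

end

end

theory Submission
  imports Defs
begin

text \<open>
  Suppose \<open>f\<close> is supported in \<open>I\<close> with mean zero and \<open>g\<close> is supported in a disjoint ball \<open>J\<close>. A
  wavelet not supported in \<open>I\<close> is constant on \<open>I\<close>, hence has coefficient zero against \<open>f\<close>, so the
  wavelet expansion of \<open>T\<^sup>-\<^sup>1 f\<close> consists of mean zero functions supported in \<open>I\<close>. A wavelet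
  supported in \<open>I\<close> has coefficient zero against \<open>g\<close>, so the expansion of \<open>T\<^sup>-\<^sup>1 g\<close> is constant on
  \<open>I\<close>. White noise therefore makes all finite partial sums for \<open>f\<close> and \<open>g\<close> uncorrelated, and this
  passes to the \<open>L\<^sup>2\<close> limit. For the jointly Gaussian real and imaginary parts, vanishing
  correlations make the joint characteristic function a product. Independence follows by applying
  Levy's one-dimensional uniqueness theorem to one coordinate at a time.
\<close>

text \<open>Values of the field are complex, so independence concerns random vectors in the plane,
  and E[psi(f) psi(g)] = 0 yields only two relations among the four covariances of real and
  imaginary parts. Orthogonality is therefore proved for all real functions s Re f + t Im f against
  s' Re g + t' Im g. They keep the supports, they inherit mean zero from f or g, and they produce
  every real linear functional of psi(f) and psi(g).

  Partial sums are handled on the side of test functions: each partial sum for psi(f) is phi at a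
  single test function. This requires wavelets to be locally constant with compact support, which is
  where regularity and completeness of the space enter: balls are compact, and maximal subballs,
  even single points, are open. For every finite set of wavelets the two approximants are exactly
  orthogonal, so passing to the limit takes no rate of convergence and no tail estimate.\<close>

subsection \<open>Independence from characteristic functions\<close>

text \<open>The weight \<open>1 + a / c\<close> is nonnegative and does not change the characteristic function of \<open>X\<close>.\<close>

lemma (in prob_space) iexp_orthogonal_imp_indicator_orthogonal_real:
  fixes X a :: "'a \<Rightarrow> real"
  assumes [measurable]: "X \<in> borel_measurable M" "a \<in> borel_measurable M"
    and c: "0 < c" "\<And>\<omega>. \<bar>a \<omega>\<bar> \<le> c"
    and orth: "\<And>s. (\<integral>\<omega>. iexp (s * X \<omega>) * complex_of_real (a \<omega>) \<partial>M) = 0"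
    and [measurable]: "A \<in> sets borel"
  shows "(\<integral>\<omega>. indicator A (X \<omega>) * a \<omega> \<partial>M) = 0"
proof -
  define w where "w \<omega> = (a \<omega> + c) / c" for \<omega>
  have [measurable]: "w \<in> borel_measurable M" unfolding w_def by simp
  have w0: "0 \<le> w \<omega>" for \<omega> using c(1) c(2)[of \<omega>] by (simp add: w_def)
  have ia: "integrable M a" using c(2) by (intro integrable_const_bound[of _ c]) auto
  have iw: "integrable M w" unfolding w_def using ia by simp
  \<comment> \<open>The case \<open>s = 0\<close> of \<open>orth\<close>: \<open>a\<close> has mean
    zero, so \<open>w\<close> integrates to 1 and \<open>N\<close> below is a probability
    measure.\<close>
  have "(\<integral>\<omega>. complex_of_real (a \<omega>) \<partial>M) = 0" using orth[of 0] by simp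
  then have a0: "(\<integral>\<omega>. a \<omega> \<partial>M) = 0" by simp
  have w1: "(\<integral>\<omega>. w \<omega> \<partial>M) = 1" unfolding w_def using ia a0 c(1) by (simp add: prob_space)
  define N where "N = density M (\<lambda>\<omega>. ennreal (w \<omega>))"
  have [simp]: "sets N = sets M" "space N = space M" by (simp_all add: N_def)
  have pN: "prob_space N"
  proof
    have "emeasure N (space N) = (\<integral>\<^sup>+\<omega>. ennreal (w \<omega>) \<partial>M)"
      by (auto simp: N_def emeasure_density intro!: nn_integral_cong)
    also have "\<dots> = 1" using nn_integral_eq_integral[OF iw] w0 w1 by simp
    finally show "emeasure N (space N) = 1" .
  qed
  have XN: "X \<in> borel_measurable N" by (simp add: N_def)
  interpret N: prob_space N by (rule pN)
  have rd: "real_distribution (distr N borel X)" "real_distribution (distr M borel X)"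
    using XN by (auto intro!: N.real_distribution_distr real_distribution_distr)
  have "char (distr N borel X) t = char (distr M borel X) t" for t
  proof -
    have i1: "integrable M (\<lambda>\<omega>. iexp (t * X \<omega>))" by (intro integrable_const_bound[of _ 1]) auto
    have i2: "integrable M (\<lambda>\<omega>. iexp (t * X \<omega>) * complex_of_real (a \<omega>))"
      using c(2) by (intro integrable_const_bound[of _ c]) (auto simp: norm_mult)
    have "char (distr N borel X) t = (\<integral>\<omega>. iexp (t * X \<omega>) \<partial>N)"
      unfolding char_def using XN by (subst integral_distr) auto
    also have "\<dots> = (\<integral>\<omega>. w \<omega> *\<^sub>R iexp (t * X \<omega>) \<partial>M)"
      unfolding N_def using w0 by (subst integral_density) auto
    also have "\<dots> = (\<integral>\<omega>. iexp (t * X \<omega>) * complex_of_real (a \<omega>) / c + iexp (t * X \<omega>) \<partial>M)"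
      using c(1) by (intro Bochner_Integration.integral_cong) (auto simp: w_def scaleR_conv_of_real field_simps)
    also have "\<dots> = (\<integral>\<omega>. iexp (t * X \<omega>) * complex_of_real (a \<omega>) / c \<partial>M) + (\<integral>\<omega>. iexp (t * X \<omega>) \<partial>M)"
      using i1 i2 by (intro Bochner_Integration.integral_add) auto
    also have "\<dots> = char (distr M borel X) t"
      unfolding char_def using orth by (subst integral_distr) auto
    finally show ?thesis .
  qed
  then have eq: "distr N borel X = distr M borel X"
    by (intro Levy_uniqueness rd ext)
  \<comment> \<open>\<open>X\<close> has the same law under \<open>N\<close> and under
    \<open>M\<close>, so the event that \<open>X\<close> lies in \<open>A\<close> has the same
    probability under both. The difference of these two probabilities is the wanted integral divided
    by \<open>c\<close>.\<close>
  have "(\<integral>\<omega>. indicator A (X \<omega>) * w \<omega> \<partial>M) = (\<integral>\<omega>. indicator A (X \<omega>) \<partial>N)"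
    unfolding N_def using w0 by (subst integral_density) (auto simp: mult.commute)
  also have "\<dots> = (\<integral>x. indicator A x \<partial>distr N borel X)"
    using XN by (subst integral_distr) auto
  also have "\<dots> = (\<integral>\<omega>. indicator A (X \<omega>) \<partial>M)"
    unfolding eq by (subst integral_distr) auto
  finally have e: "(\<integral>\<omega>. indicator A (X \<omega>) * w \<omega> \<partial>M) = (\<integral>\<omega>. indicator A (X \<omega>) \<partial>M :: real)" .
  have i1: "integrable M (\<lambda>\<omega>. indicator A (X \<omega>) :: real)"
    by (intro integrable_const_bound[of _ 1]) auto
  have i2: "integrable M (\<lambda>\<omega>. indicator A (X \<omega>) * a \<omega>)"
    using c by (intro integrable_const_bound[of _ c]) (auto simp: indicator_def)
  have "(\<integral>\<omega>. indicator A (X \<omega>) * w \<omega> \<partial>M) = (\<integral>\<omega>. indicator A (X \<omega>) * a \<omega> / c + indicator A (X \<omega>) \<partial>M)"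
    using c(1) by (intro Bochner_Integration.integral_cong) (auto simp: w_def field_simps)
  also have "\<dots> = (\<integral>\<omega>. indicator A (X \<omega>) * a \<omega> / c \<partial>M) + (\<integral>\<omega>. indicator A (X \<omega>) \<partial>M)"
    using i1 i2 by (intro Bochner_Integration.integral_add) auto
  finally show ?thesis using e c(1) by simp
qed

text \<open>Since \<open>s\<close> ranges over all reals, conjugating \<open>orth\<close> and
  replacing \<open>s\<close> by \<open>- s\<close> gives the same relation for
  \<open>cnj (u \<omega>)\<close>. It therefore holds for the real and imaginary parts of
  \<open>u\<close>, to which the real version applies.\<close>

lemma (in prob_space) iexp_orthogonal_imp_indicator_orthogonal:
  fixes X :: "'a \<Rightarrow> real" and u :: "'a \<Rightarrow> complex"
  assumes [measurable]: "X \<in> borel_measurable M" "u \<in> borel_measurable M"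
    and c: "0 < c" "\<And>\<omega>. cmod (u \<omega>) \<le> c"
    and orth: "\<And>s. (\<integral>\<omega>. iexp (s * X \<omega>) * u \<omega> \<partial>M) = 0"
    and A[measurable]: "A \<in> sets borel"
  shows "(\<integral>\<omega>. indicator A (X \<omega>) * u \<omega> \<partial>M) = 0"
proof -
  have [measurable]: "(\<lambda>\<omega>. cnj (u \<omega>)) \<in> borel_measurable M"
    by (rule borel_measurable_continuous_onI[THEN measurable_compose[OF assms(2)]]) (intro continuous_intros)
  have iu: "integrable M (\<lambda>\<omega>. iexp (s * X \<omega>) * u \<omega>)" for s
    using c(2) by (intro integrable_const_bound[of _ c]) (auto simp: norm_mult)
  have icu: "integrable M (\<lambda>\<omega>. iexp (s * X \<omega>) * cnj (u \<omega>))" for s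
    using c(2) by (intro integrable_const_bound[of _ c]) (auto simp: norm_mult)
  have cu: "(\<integral>\<omega>. iexp (s * X \<omega>) * cnj (u \<omega>) \<partial>M) = 0" for s
  proof -
    have "(\<integral>\<omega>. iexp (s * X \<omega>) * cnj (u \<omega>) \<partial>M) = (\<integral>\<omega>. cnj (iexp (- s * X \<omega>) * u \<omega>) \<partial>M)"
      by (intro Bochner_Integration.integral_cong) (auto simp: exp_cnj)
    also have "\<dots> = cnj (\<integral>\<omega>. iexp (- s * X \<omega>) * u \<omega> \<partial>M)"
      using iu by (intro integral_bounded_linear bounded_linear_cnj)
    finally show ?thesis using orth[of "- s"] by simp
  qed
  have "(\<integral>\<omega>. iexp (s * X \<omega>) * complex_of_real (Re (u \<omega>)) \<partial>M) =
    (\<integral>\<omega>. (iexp (s * X \<omega>) * u \<omega> + iexp (s * X \<omega>) * cnj (u \<omega>)) / 2 \<partial>M)" for s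
    by (intro Bochner_Integration.integral_cong) (auto simp: complex_eq_iff field_simps)
  then have re: "(\<integral>\<omega>. iexp (s * X \<omega>) * complex_of_real (Re (u \<omega>)) \<partial>M) = 0" for s
    using iu icu orth cu by simp
  have "(\<integral>\<omega>. iexp (s * X \<omega>) * complex_of_real (Im (u \<omega>)) \<partial>M) =
    (\<integral>\<omega>. (iexp (s * X \<omega>) * u \<omega> - iexp (s * X \<omega>) * cnj (u \<omega>)) / (2 * \<i>) \<partial>M)" for s
    by (intro Bochner_Integration.integral_cong) (simp_all add: right_diff_distrib[symmetric] complex_diff_cnj, simp add: complex_eq_iff)
  then have im: "(\<integral>\<omega>. iexp (s * X \<omega>) * complex_of_real (Im (u \<omega>)) \<partial>M) = 0" for s
    using iu icu orth cu by simp
  have R: "(\<integral>\<omega>. indicator A (X \<omega>) * Re (u \<omega>) \<partial>M) = 0"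
    using c abs_Re_le_cmod order_trans
    by (intro iexp_orthogonal_imp_indicator_orthogonal_real[OF _ _ c(1) _ re]) (auto, blast)
  have I: "(\<integral>\<omega>. indicator A (X \<omega>) * Im (u \<omega>) \<partial>M) = 0"
    using c abs_Im_le_cmod order_trans
    by (intro iexp_orthogonal_imp_indicator_orthogonal_real[OF _ _ c(1) _ im]) (auto, blast)
  have i: "integrable M (\<lambda>\<omega>. indicator A (X \<omega>) * u \<omega>)"
    using c by (intro integrable_const_bound[of _ c]) (auto simp: norm_mult indicator_def)
  have "Re (\<integral>\<omega>. indicator A (X \<omega>) * u \<omega> \<partial>M) = (\<integral>\<omega>. indicator A (X \<omega>) * Re (u \<omega>) \<partial>M)"
    unfolding integral_Re[OF i, symmetric]
    by (intro Bochner_Integration.integral_cong) (auto simp: indicator_def)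
  moreover have "Im (\<integral>\<omega>. indicator A (X \<omega>) * u \<omega> \<partial>M) = (\<integral>\<omega>. indicator A (X \<omega>) * Im (u \<omega>) \<partial>M)"
    unfolding integral_Im[OF i, symmetric]
    by (intro Bochner_Integration.integral_cong) (auto simp: indicator_def)
  ultimately show ?thesis using R I by (simp add: complex_eq_iff)
qed

text \<open>Centring the factor that belongs to the other pair turns the product formula into an
  orthogonality relation. There one exponential at a time can be exchanged for an indicator, the
  remaining factors being frozen in a bounded function. Four exchanges give the product rule for
  preimages of rectangles, which form an intersection-stable generator.\<close>

lemma (in prob_space) indep_var_pairs_iexp:
  fixes U1 U2 V1 V2 :: "'a \<Rightarrow> real"
  assumes [measurable]: "U1 \<in> borel_measurable M" "U2 \<in> borel_measurable M"
    "V1 \<in> borel_measurable M" "V2 \<in> borel_measurable M"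
    and fact: "\<And>s1 s2 t1 t2.
      (\<integral>\<omega>. iexp (s1 * U1 \<omega> + s2 * U2 \<omega>) * iexp (t1 * V1 \<omega> + t2 * V2 \<omega>) \<partial>M) =
      (\<integral>\<omega>. iexp (s1 * U1 \<omega> + s2 * U2 \<omega>) \<partial>M) * (\<integral>\<omega>. iexp (t1 * V1 \<omega> + t2 * V2 \<omega>) \<partial>M)"
  shows "indep_var (borel \<Otimes>\<^sub>M borel) (\<lambda>\<omega>. (U1 \<omega>, U2 \<omega>)) (borel \<Otimes>\<^sub>M borel) (\<lambda>\<omega>. (V1 \<omega>, V2 \<omega>))"
proof -
  have trig_int: "integrable M (\<lambda>\<omega>. iexp (s1 * U1 \<omega> + s2 * U2 \<omega>))"
    "integrable M (\<lambda>\<omega>. iexp (s1 * V1 \<omega> + s2 * V2 \<omega>))"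
    "integrable M (\<lambda>\<omega>. iexp (s1 * U1 \<omega> + s2 * U2 \<omega>) * iexp (t1 * V1 \<omega> + t2 * V2 \<omega>))" for s1 s2 t1 t2
    by (rule integrable_const_bound[of _ 1], auto simp: norm_mult)+
  have key: "prob ((\<lambda>\<omega>. (U1 \<omega>, U2 \<omega>)) -` (A1 \<times> A2) \<inter> space M \<inter> ((\<lambda>\<omega>. (V1 \<omega>, V2 \<omega>)) -` (B1 \<times> B2) \<inter> space M)) =
    prob ((\<lambda>\<omega>. (U1 \<omega>, U2 \<omega>)) -` (A1 \<times> A2) \<inter> space M) * prob ((\<lambda>\<omega>. (V1 \<omega>, V2 \<omega>)) -` (B1 \<times> B2) \<inter> space M)"
    if [measurable]: "A1 \<in> sets borel" "A2 \<in> sets borel" "B1 \<in> sets borel" "B2 \<in> sets borel" for A1 A2 B1 B2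
  proof -
    define a :: "'a \<Rightarrow> complex" where "a \<omega> = indicator A1 (U1 \<omega>) * indicator A2 (U2 \<omega>)" for \<omega>
    define b :: "'a \<Rightarrow> complex" where "b \<omega> = indicator B1 (V1 \<omega>) * indicator B2 (V2 \<omega>)" for \<omega>
    have [measurable]: "a \<in> borel_measurable M" "b \<in> borel_measurable M"
      unfolding a_def b_def by auto
    have ab: "cmod (a \<omega>) \<le> 1" "cmod (b \<omega>) \<le> 1" for \<omega>
      by (auto simp: a_def b_def indicator_def)
    have iab: "integrable M a" "integrable M b" "integrable M (\<lambda>\<omega>. a \<omega> * b \<omega>)"
      using ab by (auto simp: norm_mult intro!: integrable_const_bound[of _ 1] AE_I2 mult_le_one)
    \<comment> \<open>A function of modulus at most 1 has modulus at most 2 after centring; this is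
      the bound \<open>c = 2\<close> in the four exchanges below.\<close>
    have leb: "cmod (x - integral\<^sup>L M y) \<le> 2" if "cmod x \<le> 1" "\<And>\<omega>. cmod (y \<omega>) \<le> 1" "integrable M y" for x y
    proof -
      have "cmod (integral\<^sup>L M y) \<le> (\<integral>\<omega>. cmod (y \<omega>) \<partial>M)" by (rule integral_norm_bound)
      also have "\<dots> \<le> 1" using that by (intro integral_le_const) auto
      finally show ?thesis using that(1) norm_triangle_ineq4[of x "integral\<^sup>L M y"] by linarith
    qed
    \<comment> \<open>The exponential in \<open>V1\<close>, \<open>V2\<close> is centred and kept,
      while the exponentials in \<open>U1\<close> and then in \<open>U2\<close> become
      indicators.\<close>
    have 1: "(\<integral>\<omega>. a \<omega> * (iexp (t1 * V1 \<omega> + t2 * V2 \<omega>) - (\<integral>\<omega>. iexp (t1 * V1 \<omega> + t2 * V2 \<omega>) \<partial>M)) \<partial>M) = 0"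
      for t1 t2
    proof -
      define u where "u \<omega> = iexp (t1 * V1 \<omega> + t2 * V2 \<omega>) - (\<integral>\<omega>. iexp (t1 * V1 \<omega> + t2 * V2 \<omega>) \<partial>M)" for \<omega>
      have [measurable]: "u \<in> borel_measurable M" unfolding u_def by measurable
      have u2: "cmod (u \<omega>) \<le> 2" for \<omega>
        unfolding u_def using trig_int(2)[of t1 t2] by (intro leb) auto
      have u0: "(\<integral>\<omega>. iexp (s1 * U1 \<omega>) * (iexp (s2 * U2 \<omega>) * u \<omega>) \<partial>M) = 0" for s1 s2
      proof -
        have "(\<integral>\<omega>. iexp (s1 * U1 \<omega>) * (iexp (s2 * U2 \<omega>) * u \<omega>) \<partial>M) =
          (\<integral>\<omega>. iexp (s1 * U1 \<omega> + s2 * U2 \<omega>) * iexp (t1 * V1 \<omega> + t2 * V2 \<omega>) -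
             iexp (s1 * U1 \<omega> + s2 * U2 \<omega>) * (\<integral>\<omega>. iexp (t1 * V1 \<omega> + t2 * V2 \<omega>) \<partial>M) \<partial>M)"
          by (intro Bochner_Integration.integral_cong) (auto simp: u_def algebra_simps exp_add)
        also have "\<dots> = 0"
          using fact trig_int by (subst Bochner_Integration.integral_diff) auto
        finally show ?thesis .
      qed
      have "(\<integral>\<omega>. indicator A1 (U1 \<omega>) * (iexp (s2 * U2 \<omega>) * u \<omega>) \<partial>M) = 0" for s2
        using u2 by (intro iexp_orthogonal_imp_indicator_orthogonal[where c = 2] u0) (auto simp: norm_mult)
      then have "(\<integral>\<omega>. iexp (s2 * U2 \<omega>) * (indicator A1 (U1 \<omega>) * u \<omega>) \<partial>M) = 0" for s2
        by (simp add: mult.left_commute)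
      then have "(\<integral>\<omega>. indicator A2 (U2 \<omega>) * (indicator A1 (U1 \<omega>) * u \<omega>) \<partial>M) = 0"
        using u2 by (intro iexp_orthogonal_imp_indicator_orthogonal[where c = 2])
          (auto simp: norm_mult indicator_def)
      then show ?thesis unfolding u_def a_def by (simp add: ac_simps)
    qed
    \<comment> \<open>The roles are reversed: \<open>1\<close> says that the exponentials in
      \<open>V1\<close>, \<open>V2\<close> are uncorrelated with \<open>a\<close>, so now
      \<open>a\<close> is centred and the exponentials in \<open>V1\<close> and \<open>V2\<close>
      become indicators.\<close>
    have 2: "(\<integral>\<omega>. b \<omega> * (a \<omega> - (\<integral>\<omega>. a \<omega> \<partial>M)) \<partial>M) = 0"
    proof -
      define u where "u \<omega> = a \<omega> - (\<integral>\<omega>. a \<omega> \<partial>M)" for \<omega>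
      have [measurable]: "u \<in> borel_measurable M" unfolding u_def by measurable
      have u2: "cmod (u \<omega>) \<le> 2" for \<omega>
        unfolding u_def by (rule leb) (auto intro: iab ab)
      have u0: "(\<integral>\<omega>. iexp (s1 * V1 \<omega>) * (iexp (s2 * V2 \<omega>) * u \<omega>) \<partial>M) = 0" for s1 s2
      proof -
        let ?e = "\<lambda>\<omega>. iexp (s1 * V1 \<omega> + s2 * V2 \<omega>)"
        have i: "integrable M (\<lambda>\<omega>. a \<omega> * ?e \<omega>)"
          using ab by (intro integrable_const_bound[of _ 1]) (auto simp: norm_mult)
        have "(\<integral>\<omega>. a \<omega> * (?e \<omega> - integral\<^sup>L M ?e) \<partial>M) = (\<integral>\<omega>. a \<omega> * ?e \<omega> - a \<omega> * integral\<^sup>L M ?e \<partial>M)"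
          by (simp add: algebra_simps)
        also have "\<dots> = (\<integral>\<omega>. a \<omega> * ?e \<omega> \<partial>M) - integral\<^sup>L M a * integral\<^sup>L M ?e"
          using i iab by (subst Bochner_Integration.integral_diff) auto
        finally have e: "(\<integral>\<omega>. a \<omega> * ?e \<omega> \<partial>M) = integral\<^sup>L M a * integral\<^sup>L M ?e" using 1 by simp
        have "(\<integral>\<omega>. iexp (s1 * V1 \<omega>) * (iexp (s2 * V2 \<omega>) * u \<omega>) \<partial>M) =
          (\<integral>\<omega>. a \<omega> * ?e \<omega> - integral\<^sup>L M a * ?e \<omega> \<partial>M)"
          by (intro Bochner_Integration.integral_cong) (auto simp: u_def algebra_simps exp_add)
        also have "\<dots> = 0"
          using i e trig_int by (subst Bochner_Integration.integral_diff) auto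
        finally show ?thesis .
      qed
      have "(\<integral>\<omega>. indicator B1 (V1 \<omega>) * (iexp (s2 * V2 \<omega>) * u \<omega>) \<partial>M) = 0" for s2
        using u2 by (intro iexp_orthogonal_imp_indicator_orthogonal[where c = 2] u0) (auto simp: norm_mult)
      then have "(\<integral>\<omega>. iexp (s2 * V2 \<omega>) * (indicator B1 (V1 \<omega>) * u \<omega>) \<partial>M) = 0" for s2
        by (simp add: mult.left_commute)
      then have "(\<integral>\<omega>. indicator B2 (V2 \<omega>) * (indicator B1 (V1 \<omega>) * u \<omega>) \<partial>M) = 0"
        using u2 by (intro iexp_orthogonal_imp_indicator_orthogonal[where c = 2])
          (auto simp: norm_mult indicator_def)
      then show ?thesis unfolding u_def b_def by (simp add: ac_simps)
    qed
    have "(\<integral>\<omega>. b \<omega> * (a \<omega> - (\<integral>\<omega>. a \<omega> \<partial>M)) \<partial>M) = (\<integral>\<omega>. a \<omega> * b \<omega> - (\<integral>\<omega>. a \<omega> \<partial>M) * b \<omega> \<partial>M)"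
      by (simp add: algebra_simps)
    also have "\<dots> = (\<integral>\<omega>. a \<omega> * b \<omega> \<partial>M) - integral\<^sup>L M a * integral\<^sup>L M b"
      using iab by (subst Bochner_Integration.integral_diff) auto
    finally have 3: "(\<integral>\<omega>. a \<omega> * b \<omega> \<partial>M) = integral\<^sup>L M a * integral\<^sup>L M b" using 2 by simp
    have int: "(\<integral>\<omega>. indicator S \<omega> \<partial>M) = complex_of_real (prob S)" if "S \<in> sets M" for S
    proof -
      have "(\<integral>\<omega>. complex_of_real (indicator S \<omega>) \<partial>M) = complex_of_real (prob S)"
        using that sets.sets_into_space[OF that] by (subst integral_complex_of_real) (simp add: Int_absorb2)
      then show ?thesis by (simp add: of_real_indicator)
    qed
    define SA where "SA = (\<lambda>\<omega>. (U1 \<omega>, U2 \<omega>)) -` (A1 \<times> A2) \<inter> space M"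
    define SB where "SB = (\<lambda>\<omega>. (V1 \<omega>, V2 \<omega>)) -` (B1 \<times> B2) \<inter> space M"
    have S: "SA \<in> sets M" "SB \<in> sets M"
      unfolding SA_def SB_def by (intro measurable_sets[of _ M "borel \<Otimes>\<^sub>M borel"]; auto)+
    have "integral\<^sup>L M a = (\<integral>\<omega>. indicator SA \<omega> \<partial>M)"
      by (intro Bochner_Integration.integral_cong) (auto simp: a_def SA_def indicator_def)
    moreover have "integral\<^sup>L M b = (\<integral>\<omega>. indicator SB \<omega> \<partial>M)"
      by (intro Bochner_Integration.integral_cong) (auto simp: b_def SB_def indicator_def)
    moreover have "(\<integral>\<omega>. a \<omega> * b \<omega> \<partial>M) = (\<integral>\<omega>. indicator (SA \<inter> SB) \<omega> \<partial>M)"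
      by (intro Bochner_Integration.integral_cong) (auto simp: a_def b_def SA_def SB_def indicator_def)
    ultimately have "complex_of_real (prob (SA \<inter> SB)) = complex_of_real (prob SA * prob SB)"
      using 3 S by (simp add: int)
    then show ?thesis unfolding SA_def[symmetric] SB_def[symmetric] by (simp only: of_real_eq_iff)
  qed
  define G where "G = {A \<times> B |A B. A \<in> sets (borel :: real measure) \<and> B \<in> sets (borel :: real measure)}"
  have G: "Int_stable G" unfolding G_def using Int_stable_pair_measure_generator[of "borel :: real measure" "borel :: real measure"] .
  have sG: "sets (borel \<Otimes>\<^sub>M borel :: (real \<times> real) measure) = sigma_sets UNIV G"
    unfolding sets_pair_measure G_def by simp
  have gen: "{X -` A \<inter> space M |A. A \<in> sets (borel \<Otimes>\<^sub>M borel)} =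
      sigma_sets (space M) {X -` A \<inter> space M |A. A \<in> G}"
    for X :: "'a \<Rightarrow> real \<times> real"
    unfolding sG by (rule sigma_sets_vimage_commute) auto
  have st: "Int_stable {X -` A \<inter> space M |A. A \<in> G}" for X :: "'a \<Rightarrow> real \<times> real"
  proof (rule Int_stableI)
    fix a b assume "a \<in> {X -` A \<inter> space M |A. A \<in> G}" "b \<in> {X -` A \<inter> space M |A. A \<in> G}"
    then obtain A B where "A \<in> G" "B \<in> G" "a = X -` A \<inter> space M" "b = X -` B \<inter> space M" by auto
    then show "a \<inter> b \<in> {X -` A \<inter> space M |A. A \<in> G}"
      using Int_stableD[OF G, of A B] by (auto intro!: exI[of _ "A \<inter> B"])
  qed
  have Gs: "A \<in> sets (borel \<Otimes>\<^sub>M borel)" if "A \<in> G" for A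
    using that unfolding sG by auto
  have "indep_set {(\<lambda>\<omega>. (U1 \<omega>, U2 \<omega>)) -` A \<inter> space M |A. A \<in> G} {(\<lambda>\<omega>. (V1 \<omega>, V2 \<omega>)) -` A \<inter> space M |A. A \<in> G}"
    unfolding indep_sets2_eq
  proof (intro conjI ballI)
    show "{(\<lambda>\<omega>. (U1 \<omega>, U2 \<omega>)) -` A \<inter> space M |A. A \<in> G} \<subseteq> events"
      using Gs by (auto intro!: measurable_sets[of _ M "borel \<Otimes>\<^sub>M borel"])
    show "{(\<lambda>\<omega>. (V1 \<omega>, V2 \<omega>)) -` A \<inter> space M |A. A \<in> G} \<subseteq> events"
      using Gs by (auto intro!: measurable_sets[of _ M "borel \<Otimes>\<^sub>M borel"])
  next
    fix a b assume "a \<in> {(\<lambda>\<omega>. (U1 \<omega>, U2 \<omega>)) -` A \<inter> space M |A. A \<in> G}"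
      "b \<in> {(\<lambda>\<omega>. (V1 \<omega>, V2 \<omega>)) -` A \<inter> space M |A. A \<in> G}"
    then show "prob (a \<inter> b) = prob a * prob b"
      unfolding G_def using key by (elim CollectE exE conjE) (simp only:)
  qed
  from indep_set_sigma_sets[OF this st st]
  \<comment> \<open>\<open>indep_var_eq\<close> applies \<open>sigma_sets\<close> to families that
    \<open>gen\<close> already writes as generated sigma-algebras; the double closure
    collapses.\<close>
  show ?thesis
    unfolding indep_var_eq gen by (subst (1 2) sigma_sets_sigma_sets_eq) auto
qed

text \<open>The description of independence by joint distributions sees only values on
  \<open>space M\<close>. This matters because a field is known to be linear, and real on real test
  functions, only there, so its splitting into two real variables is not an equality of functions on
  the whole type.\<close>

lemma (in prob_space) indep_var_cong_space:
  assumes indep: "indep_var S X T Y"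
    and eq: "\<And>\<omega>. \<omega> \<in> space M \<Longrightarrow> X' \<omega> = X \<omega>" "\<And>\<omega>. \<omega> \<in> space M \<Longrightarrow> Y' \<omega> = Y \<omega>"
  shows "indep_var S X' T Y'"
proof -
  have "distr M S X' = distr M S X" "distr M T Y' = distr M T Y"
    "distr M (S \<Otimes>\<^sub>M T) (\<lambda>\<omega>. (X' \<omega>, Y' \<omega>)) = distr M (S \<Otimes>\<^sub>M T) (\<lambda>\<omega>. (X \<omega>, Y \<omega>))"
    using eq by (auto intro!: distr_cong)
  moreover have "X' \<in> measurable M S \<longleftrightarrow> X \<in> measurable M S" "Y' \<in> measurable M T \<longleftrightarrow> Y \<in> measurable M T"
    using eq by (auto intro!: measurable_cong)
  ultimately show ?thesis using indep unfolding indep_var_distribution_eq by simp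
qed

subsection \<open>Limits in mean square\<close>

lemma integrable_mult_of_square_integrable:
  fixes X Y :: "'a \<Rightarrow> complex"
  assumes [measurable]: "X \<in> borel_measurable M" "Y \<in> borel_measurable M"
    and sq: "integrable M (\<lambda>\<omega>. (cmod (X \<omega>))\<^sup>2)" "integrable M (\<lambda>\<omega>. (cmod (Y \<omega>))\<^sup>2)"
  shows "integrable M (\<lambda>\<omega>. X \<omega> * Y \<omega>)"
proof (rule Bochner_Integration.integrable_bound)
  show "integrable M (\<lambda>\<omega>. (cmod (X \<omega>))\<^sup>2 + (cmod (Y \<omega>))\<^sup>2)" using sq by simp
  have "a * b \<le> a\<^sup>2 + b\<^sup>2" if "0 \<le> a" "0 \<le> b" for a b :: real
    using that sum_squares_bound[of a b] mult_nonneg_nonneg[OF that] by linarith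
  then show "AE \<omega> in M. norm (X \<omega> * Y \<omega>) \<le> norm ((cmod (X \<omega>))\<^sup>2 + (cmod (Y \<omega>))\<^sup>2)"
    by (auto simp: norm_mult)
qed auto

text \<open>The identity X Y - X' Y' = (X - X') Y + X (Y - Y') - (X - X') (Y - Y') leaves only the
  fixed limits and the two distances on the right, so no uniform bound on the approximants X', Y'
  has to be established. Products carry no conjugate, matching the bilinear covariance of white
  noise.\<close>

lemma (in prob_space) L2_limit_orthogonal:
  fixes X Y :: "'a \<Rightarrow> complex" and XF YF :: "'i \<Rightarrow> 'a \<Rightarrow> complex"
  assumes [measurable]: "X \<in> borel_measurable M" "Y \<in> borel_measurable M"
    and meas: "\<forall>\<^sub>F F in L. XF F \<in> borel_measurable M" "\<forall>\<^sub>F F in L. YF F \<in> borel_measurable M"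
    and sq: "integrable M (\<lambda>\<omega>. (cmod (X \<omega>))\<^sup>2)" "integrable M (\<lambda>\<omega>. (cmod (Y \<omega>))\<^sup>2)"
    and limX: "((\<lambda>F. \<integral>\<^sup>+\<omega>. ennreal ((cmod (X \<omega> - XF F \<omega>))\<^sup>2) \<partial>M) \<longlongrightarrow> 0) L"
    and limY: "((\<lambda>F. \<integral>\<^sup>+\<omega>. ennreal ((cmod (Y \<omega> - YF F \<omega>))\<^sup>2) \<partial>M) \<longlongrightarrow> 0) L"
    and L: "L \<noteq> bot"
    and orth: "\<forall>\<^sub>F F in L. (\<integral>\<omega>. XF F \<omega> * YF F \<omega> \<partial>M) = 0"
  shows "(\<integral>\<omega>. X \<omega> * Y \<omega> \<partial>M) = 0"
proof -
  define x where "x = (\<integral>\<omega>. (cmod (X \<omega>))\<^sup>2 \<partial>M)"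
  define y where "y = (\<integral>\<omega>. (cmod (Y \<omega>))\<^sup>2 \<partial>M)"
  have xy: "0 \<le> x" "0 \<le> y" unfolding x_def y_def by simp_all
  \<comment> \<open>Weighted arithmetic-geometric mean inequality, used in place of Cauchy-Schwarz.
    The fixed factor \<open>b\<close> is damped by \<open>\<delta>\<close>; the small factor
    \<open>a\<close> will have second moment at most delta^2, so division by \<open>\<delta>\<close>
    still leaves \<open>\<delta>\<close>.\<close>
  have amgm: "a * b \<le> (\<delta> * b\<^sup>2 + a\<^sup>2 / \<delta>) / 2" if "0 < \<delta>" for a b \<delta> :: real
  proof -
    have "0 \<le> (\<delta> * b - a)\<^sup>2 / \<delta>" using that by simp
    then show ?thesis using that by (simp add: power2_eq_square field_simps)
  qed
  have iXY: "integrable M (\<lambda>\<omega>. X \<omega> * Y \<omega>)"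
    using sq by (intro integrable_mult_of_square_integrable) auto
  have bound: "cmod (\<integral>\<omega>. X \<omega> * Y \<omega> \<partial>M) \<le> \<delta> * (x + y + 2)" if \<delta>: "0 < \<delta>" "\<delta> < 1" for \<delta> :: real
  proof -
    have "\<forall>\<^sub>F F in L. (\<integral>\<^sup>+\<omega>. ennreal ((cmod (X \<omega> - XF F \<omega>))\<^sup>2) \<partial>M) < ennreal (\<delta>\<^sup>2)"
      "\<forall>\<^sub>F F in L. (\<integral>\<^sup>+\<omega>. ennreal ((cmod (Y \<omega> - YF F \<omega>))\<^sup>2) \<partial>M) < ennreal (\<delta>\<^sup>2)"
      using order_tendstoD(2)[OF limX, of "ennreal (\<delta>\<^sup>2)"] order_tendstoD(2)[OF limY, of "ennreal (\<delta>\<^sup>2)"] \<delta>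
      by auto
    with orth meas have "\<forall>\<^sub>F F in L. (\<integral>\<^sup>+\<omega>. ennreal ((cmod (X \<omega> - XF F \<omega>))\<^sup>2) \<partial>M) < ennreal (\<delta>\<^sup>2) \<and>
      (\<integral>\<^sup>+\<omega>. ennreal ((cmod (Y \<omega> - YF F \<omega>))\<^sup>2) \<partial>M) < ennreal (\<delta>\<^sup>2) \<and>
      (\<integral>\<omega>. XF F \<omega> * YF F \<omega> \<partial>M) = 0 \<and> XF F \<in> borel_measurable M \<and> YF F \<in> borel_measurable M"
      by eventually_elim auto
    then obtain F where F: "(\<integral>\<^sup>+\<omega>. ennreal ((cmod (X \<omega> - XF F \<omega>))\<^sup>2) \<partial>M) < ennreal (\<delta>\<^sup>2)"
      "(\<integral>\<^sup>+\<omega>. ennreal ((cmod (Y \<omega> - YF F \<omega>))\<^sup>2) \<partial>M) < ennreal (\<delta>\<^sup>2)"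
      "(\<integral>\<omega>. XF F \<omega> * YF F \<omega> \<partial>M) = 0"
      and [measurable]: "XF F \<in> borel_measurable M" "YF F \<in> borel_measurable M"
      using eventually_happens'[OF L] by auto
    define A where "A \<omega> = cmod (X \<omega> - XF F \<omega>)" for \<omega>
    define B where "B \<omega> = cmod (Y \<omega> - YF F \<omega>)" for \<omega>
    have [measurable]: "A \<in> borel_measurable M" "B \<in> borel_measurable M"
      unfolding A_def B_def by auto
    have small: "integrable M (\<lambda>\<omega>. (h \<omega>)\<^sup>2) \<and> (\<integral>\<omega>. (h \<omega>)\<^sup>2 \<partial>M) \<le> \<delta>\<^sup>2"
      if [measurable]: "h \<in> borel_measurable M" and *: "(\<integral>\<^sup>+\<omega>. ennreal ((h \<omega>)\<^sup>2) \<partial>M) < ennreal (\<delta>\<^sup>2)"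
      for h :: "'a \<Rightarrow> real"
    proof -
      have i: "integrable M (\<lambda>\<omega>. (h \<omega>)\<^sup>2)"
        using * by (intro integrableI_bounded) (auto simp: less_top intro: less_trans[OF _ ennreal_less_top])
      then have "ennreal (\<integral>\<omega>. (h \<omega>)\<^sup>2 \<partial>M) < ennreal (\<delta>\<^sup>2)"
        using * by (simp add: nn_integral_eq_integral)
      then show ?thesis using i by (simp add: ennreal_less_iff)
    qed
    have A: "integrable M (\<lambda>\<omega>. (A \<omega>)\<^sup>2)" "(\<integral>\<omega>. (A \<omega>)\<^sup>2 \<partial>M) \<le> \<delta>\<^sup>2"
      using small[of A] F(1) by (auto simp: A_def)
    have B: "integrable M (\<lambda>\<omega>. (B \<omega>)\<^sup>2)" "(\<integral>\<omega>. (B \<omega>)\<^sup>2 \<partial>M) \<le> \<delta>\<^sup>2"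
      using small[of B] F(2) by (auto simp: B_def)
    define D where "D \<omega> = X \<omega> * Y \<omega> - XF F \<omega> * YF F \<omega>" for \<omega>
    have [measurable]: "D \<in> borel_measurable M" unfolding D_def by measurable
    define G where "G \<omega> = (\<delta> * (cmod (Y \<omega>))\<^sup>2 + (A \<omega>)\<^sup>2 / \<delta>) / 2 +
      (\<delta> * (cmod (X \<omega>))\<^sup>2 + (B \<omega>)\<^sup>2 / \<delta>) / 2 + ((B \<omega>)\<^sup>2 + (A \<omega>)\<^sup>2) / 2" for \<omega>
    have iG: "integrable M G" unfolding G_def using A B sq by auto
    have DG: "cmod (D \<omega>) \<le> G \<omega>" for \<omega>
    proof -
      have "D \<omega> = (X \<omega> - XF F \<omega>) * Y \<omega> + X \<omega> * (Y \<omega> - YF F \<omega>) - (X \<omega> - XF F \<omega>) * (Y \<omega> - YF F \<omega>)"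
        by (simp add: D_def algebra_simps)
      then have "cmod (D \<omega>) \<le> cmod ((X \<omega> - XF F \<omega>) * Y \<omega>) + cmod (X \<omega> * (Y \<omega> - YF F \<omega>)) +
        cmod ((X \<omega> - XF F \<omega>) * (Y \<omega> - YF F \<omega>))"
        by (auto intro: order_trans[OF norm_triangle_ineq4] add_right_mono norm_triangle_ineq)
      then have "cmod (D \<omega>) \<le> A \<omega> * cmod (Y \<omega>) + cmod (X \<omega>) * B \<omega> + A \<omega> * B \<omega>"
        unfolding A_def B_def norm_mult .
      also have "\<dots> \<le> G \<omega>"
        unfolding G_def using amgm[OF \<delta>(1), of "A \<omega>" "cmod (Y \<omega>)"] amgm[OF \<delta>(1), of "B \<omega>" "cmod (X \<omega>)"]
          amgm[of 1 "A \<omega>" "B \<omega>"] by (simp add: mult.commute add_divide_distrib)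
      finally show ?thesis .
    qed
    have iD: "integrable M D"
      by (rule Bochner_Integration.integrable_bound[OF iG]) (use DG in \<open>auto intro!: AE_I2 order_trans[OF _ abs_ge_self]\<close>)
    have "(\<integral>\<omega>. X \<omega> * Y \<omega> - D \<omega> \<partial>M) = 0" using F(3) by (simp add: D_def)
    then have "(\<integral>\<omega>. X \<omega> * Y \<omega> \<partial>M) = (\<integral>\<omega>. D \<omega> \<partial>M)" using iXY iD by simp
    then have "cmod (\<integral>\<omega>. X \<omega> * Y \<omega> \<partial>M) \<le> (\<integral>\<omega>. cmod (D \<omega>) \<partial>M)" by simp
    also have "\<dots> \<le> (\<integral>\<omega>. G \<omega> \<partial>M)" using iD iG DG by (intro integral_mono) auto
    also have "\<dots> = (\<delta> * y + (\<integral>\<omega>. (A \<omega>)\<^sup>2 \<partial>M) / \<delta>) / 2 + (\<delta> * x + (\<integral>\<omega>. (B \<omega>)\<^sup>2 \<partial>M) / \<delta>) / 2 +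
      ((\<integral>\<omega>. (B \<omega>)\<^sup>2 \<partial>M) + (\<integral>\<omega>. (A \<omega>)\<^sup>2 \<partial>M)) / 2"
      unfolding G_def x_def y_def using A B sq by simp
    also have "\<dots> \<le> (\<delta> * y + \<delta>\<^sup>2 / \<delta>) / 2 + (\<delta> * x + \<delta>\<^sup>2 / \<delta>) / 2 + (\<delta>\<^sup>2 + \<delta>\<^sup>2) / 2"
      using A(2) B(2) \<delta> by (intro add_mono divide_right_mono) auto
    also have "\<dots> = \<delta> * (x / 2 + y / 2 + 1 + \<delta>)"
      using \<delta> by (simp add: power2_eq_square field_simps)
    also have "\<dots> \<le> \<delta> * (x + y + 2)"
      using \<delta> xy by (intro mult_left_mono) auto
    finally show ?thesis .
  qed
  show ?thesis
  proof (rule ccontr)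
    assume "\<not> ?thesis"
    then have e: "0 < cmod (\<integral>\<omega>. X \<omega> * Y \<omega> \<partial>M)" by simp
    \<comment> \<open>The minimum with \<open>1/2\<close> keeps \<open>\<delta>\<close> below 1, and
      the extra factor 2 makes the bound half of the modulus it should dominate.\<close>
    define \<delta> where "\<delta> = min (1/2) (cmod (\<integral>\<omega>. X \<omega> * Y \<omega> \<partial>M) / (2 * (x + y + 2)))"
    have \<delta>: "0 < \<delta>" "\<delta> < 1" unfolding \<delta>_def using e xy by auto
    have "\<delta> * (x + y + 2) \<le> cmod (\<integral>\<omega>. X \<omega> * Y \<omega> \<partial>M) / (2 * (x + y + 2)) * (x + y + 2)"
      unfolding \<delta>_def using xy by (intro mult_right_mono) auto
    also have "\<dots> = cmod (\<integral>\<omega>. X \<omega> * Y \<omega> \<partial>M) / 2" using xy by (simp add: field_simps)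
    finally show False using bound[OF \<delta>] e by linarith
  qed
qed

subsection \<open>Gaussian variables\<close>

lemma (in prob_space) gaussian_variable_square_integrable:
  assumes "gaussian_variable M X"
  shows "integrable M (\<lambda>\<omega>. (X \<omega>)\<^sup>2)"
proof -
  have X[measurable]: "X \<in> borel_measurable M" using assms unfolding gaussian_variable_def by blast
  consider m where "AE \<omega> in M. X \<omega> = m"
    | m s where "0 < s" "distributed M lborel X (normal_density m s)"
    using assms unfolding gaussian_variable_def by blast
  then show ?thesis
  proof cases
    case 1
    then show ?thesis by (intro integrable_const_bound[of _ "m\<^sup>2"]) auto
  next
    case 2
    have "integrable lborel (\<lambda>x. normal_density m s x * (x - m)^2 + 2 * m * (normal_density m s x * x)
        - m\<^sup>2 * normal_density m s x)"
      using integrable_normal_moment[OF 2(1), of m 2] integrable_normal_moment_nz_1[OF 2(1), of m]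
        integrable_normal_density[OF 2(1), of m]
      by auto
    moreover have "normal_density m s x * (x - m)^2 + 2 * m * (normal_density m s x * x)
        - m\<^sup>2 * normal_density m s x = normal_density m s x * x\<^sup>2" for x
      by (simp add: power2_eq_square algebra_simps)
    ultimately have "integrable lborel (\<lambda>x. normal_density m s x * x\<^sup>2)" by simp
    then show ?thesis using distributed_integrable[OF 2(2), of "\<lambda>x. x\<^sup>2"] by simp
  qed
qed

text \<open>In the nondegenerate case, the characteristic function of the standardized variable
  \<open>X \<omega> / s\<close> at the point \<open>s\<close> is the left-hand side. In the
  degenerate case the constant must be 0 and the formula reads 1 = exp 0.\<close>

lemma (in prob_space) gaussian_variable_iexp:
  assumes "gaussian_variable M X" "(\<integral>\<omega>. X \<omega> \<partial>M) = 0"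
  shows "(\<integral>\<omega>. iexp (X \<omega>) \<partial>M) = exp (- complex_of_real (\<integral>\<omega>. (X \<omega>)\<^sup>2 \<partial>M) / 2)"
proof -
  have X[measurable]: "X \<in> borel_measurable M" using assms unfolding gaussian_variable_def by blast
  consider m where "AE \<omega> in M. X \<omega> = m"
    | m s where "0 < s" "distributed M lborel X (normal_density m s)"
    using assms unfolding gaussian_variable_def by blast
  then show ?thesis
  proof cases
    case 1
    have "(\<integral>\<omega>. X \<omega> \<partial>M) = (\<integral>\<omega>. m \<partial>M)" using 1 by (intro integral_cong_AE) auto
    then have m: "m = 0" using assms(2) by (simp add: prob_space)
    have "(\<integral>\<omega>. iexp (X \<omega>) \<partial>M) = (\<integral>\<omega>. 1 \<partial>M)" using 1 m by (intro integral_cong_AE) auto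
    moreover have "(\<integral>\<omega>. (X \<omega>)\<^sup>2 \<partial>M) = (\<integral>\<omega>. 0 \<partial>M)" using 1 m by (intro integral_cong_AE) auto
    ultimately show ?thesis by (simp add: prob_space)
  next
    case 2
    have m: "m = 0" using normal_distributed_expectation[OF 2] assms(2) by simp
    have var: "(\<integral>\<omega>. (X \<omega>)\<^sup>2 \<partial>M) = s\<^sup>2" using normal_distributed_variance[OF 2] assms(2) by simp
    have d: "distributed M lborel (\<lambda>\<omega>. X \<omega> / s) std_normal_density"
      using normal_standard_normal_convert[OF 2(1), of X m] 2(2) m by simp
    have [measurable]: "(\<lambda>\<omega>. X \<omega> / s) \<in> borel_measurable M" by simp
    have "char std_normal_distribution s = char (distr M lborel (\<lambda>\<omega>. X \<omega> / s)) s"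
      unfolding distributed_distr_eq_density[OF d] ..
    also have "\<dots> = (\<integral>\<omega>. iexp (s * (X \<omega> / s)) \<partial>M)"
      unfolding char_def by (subst integral_distr) auto
    also have "\<dots> = (\<integral>\<omega>. iexp (X \<omega>) \<partial>M)" using 2(1) by simp
    finally show ?thesis
      unfolding char_std_normal_distribution var by (simp flip: exp_of_real)
  qed
qed

text \<open>The exponent of a centred Gaussian characteristic function is minus half the variance,
  and variances of uncorrelated variables add. Joint Gaussianity enters through the sum alone,
  because frequencies are absorbed into \<open>X\<close> and \<open>Y\<close>.\<close>

lemma (in prob_space) gaussian_uncorrelated_iexp:
  fixes X Y :: "'a \<Rightarrow> real"
  assumes X: "gaussian_variable M X" "(\<integral>\<omega>. X \<omega> \<partial>M) = 0"
    and Y: "gaussian_variable M Y" "(\<integral>\<omega>. Y \<omega> \<partial>M) = 0"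
    and XY: "gaussian_variable M (\<lambda>\<omega>. X \<omega> + Y \<omega>)" "(\<integral>\<omega>. X \<omega> * Y \<omega> \<partial>M) = 0"
  shows "(\<integral>\<omega>. iexp (X \<omega>) * iexp (Y \<omega>) \<partial>M) = (\<integral>\<omega>. iexp (X \<omega>) \<partial>M) * (\<integral>\<omega>. iexp (Y \<omega>) \<partial>M)"
proof -
  have [measurable]: "X \<in> borel_measurable M" "Y \<in> borel_measurable M"
    using X Y unfolding gaussian_variable_def by auto
  have sq: "integrable M (\<lambda>\<omega>. (X \<omega>)\<^sup>2)" "integrable M (\<lambda>\<omega>. (Y \<omega>)\<^sup>2)"
    using X Y gaussian_variable_square_integrable by auto
  have iX: "integrable M X" "integrable M Y"
    using sq by (auto intro: square_integrable_imp_integrable)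
  have iXY: "integrable M (\<lambda>\<omega>. X \<omega> * Y \<omega>)"
    using integrable_mult_of_square_integrable[of "\<lambda>\<omega>. complex_of_real (X \<omega>)" M "\<lambda>\<omega>. complex_of_real (Y \<omega>)"] sq
    by (simp flip: of_real_mult add: complex_of_real_integrable_eq)
  have "(\<integral>\<omega>. (X \<omega> + Y \<omega>)\<^sup>2 \<partial>M) = (\<integral>\<omega>. (X \<omega>)\<^sup>2 + (Y \<omega>)\<^sup>2 + 2 * (X \<omega> * Y \<omega>) \<partial>M)"
    by (simp add: power2_sum mult.assoc)
  also have "\<dots> = (\<integral>\<omega>. (X \<omega>)\<^sup>2 \<partial>M) + (\<integral>\<omega>. (Y \<omega>)\<^sup>2 \<partial>M)"
    using sq iXY XY(2) by simp
  finally have var: "(\<integral>\<omega>. (X \<omega> + Y \<omega>)\<^sup>2 \<partial>M) = (\<integral>\<omega>. (X \<omega>)\<^sup>2 \<partial>M) + (\<integral>\<omega>. (Y \<omega>)\<^sup>2 \<partial>M)" .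
  have "(\<integral>\<omega>. iexp (X \<omega>) * iexp (Y \<omega>) \<partial>M) = (\<integral>\<omega>. iexp (X \<omega> + Y \<omega>) \<partial>M)"
    by (simp add: exp_add distrib_left)
  also have "\<dots> = exp (- complex_of_real (\<integral>\<omega>. (X \<omega> + Y \<omega>)\<^sup>2 \<partial>M) / 2)"
    using X Y iX by (intro gaussian_variable_iexp[OF XY(1)]) simp
  also have "\<dots> = (\<integral>\<omega>. iexp (X \<omega>) \<partial>M) * (\<integral>\<omega>. iexp (Y \<omega>) \<partial>M)"
    unfolding gaussian_variable_iexp[OF X] gaussian_variable_iexp[OF Y] var
    by (subst exp_add[symmetric], intro arg_cong[where f = exp]) (simp add: add_divide_distrib)
  finally show ?thesis .
qed

subsection \<open>Test functions and distributions\<close>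

text \<open>Local constancy lets \<open>G\<close> be an arbitrary function, and
  \<open>G 0 0 = 0\<close> keeps the support inside the union of two compact supports. Sums,
  multiples, conjugates, and real and imaginary parts are all covered at once.\<close>

lemma test_functions_comp2:
  assumes f: "f \<in> test_functions" and g: "g \<in> test_functions" and G: "G 0 0 = 0"
  shows "(\<lambda>x. G (f x) (g x)) \<in> test_functions"
  unfolding test_functions_def
proof (intro CollectI conjI allI)
  fix x
  obtain U where U: "open U" "x \<in> U" "f constant_on U"
    using f unfolding test_functions_def by blast
  obtain V where V: "open V" "x \<in> V" "g constant_on V"
    using g unfolding test_functions_def by blast
  have "(\<lambda>x. G (f x) (g x)) constant_on (U \<inter> V)"
    using U(3) V(3) unfolding constant_on_def by auto
  then show "\<exists>U. open U \<and> x \<in> U \<and> (\<lambda>x. G (f x) (g x)) constant_on U"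
    using U V by (intro exI[of _ "U \<inter> V"]) auto
next
  have "{x. G (f x) (g x) \<noteq> 0} \<subseteq> {x. f x \<noteq> 0} \<union> {x. g x \<noteq> 0}" using G by auto
  then have "closure {x. G (f x) (g x) \<noteq> 0} \<subseteq> closure {x. f x \<noteq> 0} \<union> closure {x. g x \<noteq> 0}"
    unfolding closure_Un[symmetric] by (rule closure_mono)
  moreover have "compact ((closure {x. f x \<noteq> 0} \<union> closure {x. g x \<noteq> 0}) \<inter> closure {x. G (f x) (g x) \<noteq> 0})"
    using f g unfolding test_functions_def by (intro compact_Int_closed compact_Un) auto
  ultimately show "compact (closure {x. G (f x) (g x) \<noteq> 0})" by (simp add: Int_absorb1)
qed

lemma test_functions_comp:
  assumes "f \<in> test_functions" "G 0 = 0"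
  shows "(\<lambda>x. G (f x)) \<in> test_functions"
  using test_functions_comp2[OF assms(1,1), of "\<lambda>a _. G a"] assms(2) by simp

lemma zero_test_function: "(\<lambda>x. 0) \<in> test_functions"
  unfolding test_functions_def constant_on_def by auto

lemma test_functions_sum:
  assumes "\<And>i. i \<in> F \<Longrightarrow> f i \<in> test_functions"
  shows "(\<lambda>x. \<Sum>i\<in>F. a i * f i x) \<in> test_functions"
  using assms
proof (induction F rule: infinite_finite_induct)
  case (insert i F)
  then show ?case
    using test_functions_comp2[of "f i" "\<lambda>x. \<Sum>i\<in>F. a i * f i x" "\<lambda>u v. a i * u + v"] by simp
qed (simp_all add: zero_test_function)

lemma continuous_test_function:
  assumes "f \<in> test_functions"
  shows "continuous_on UNIV f"
proof (rule continuous_at_imp_continuous_on, rule ballI)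
  fix x
  obtain U c where U: "open U" "x \<in> U" "\<And>y. y \<in> U \<Longrightarrow> f y = c"
    using assms unfolding test_functions_def constant_on_def by blast
  have "\<forall>\<^sub>F y in nhds x. y \<in> U" using U(1,2) by (rule eventually_nhds_in_open)
  then have "\<forall>\<^sub>F y in nhds x. f y = c" by eventually_elim (rule U(3))
  then have "isCont f x = isCont (\<lambda>_. c) x" by (rule isCont_cong)
  then show "isCont f x" by simp
qed

lemma distributions_linear:
  assumes "u \<in> distributions" "f \<in> test_functions" "g \<in> test_functions"
  shows "u (\<lambda>x. a * f x + b * g x) = a * u f + b * u g"
  using assms unfolding distributions_def by blast

lemma distributions_sum:
  assumes u: "u \<in> distributions" and f: "\<And>i. i \<in> F \<Longrightarrow> f i \<in> test_functions"
  shows "u (\<lambda>x. \<Sum>i\<in>F. a i * f i x) = (\<Sum>i\<in>F. a i * u (f i))"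
proof -
  have z: "u (\<lambda>x. 0) = 0"
    using distributions_linear[OF u zero_test_function zero_test_function, of 0 0] by simp
  show ?thesis
    using f
  proof (induction F rule: infinite_finite_induct)
    case (insert i F)
    have "(\<lambda>x. \<Sum>i\<in>F. a i * f i x) \<in> test_functions"
      using insert by (intro test_functions_sum) auto
    then show ?case
      using distributions_linear[OF u, of "f i" "\<lambda>x. \<Sum>i\<in>F. a i * f i x" "a i" 1] insert by simp
  qed (simp_all add: z)
qed

lemma real_test_function_Re_Im:
  assumes "f \<in> test_functions"
  shows "(\<lambda>x. complex_of_real (Re (f x))) \<in> real_test_functions"
    "(\<lambda>x. complex_of_real (Im (f x))) \<in> real_test_functions"
  using test_functions_comp[OF assms, of "\<lambda>z. complex_of_real (Re z)"]
    test_functions_comp[OF assms, of "\<lambda>z. complex_of_real (Im z)"]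
  unfolding real_test_functions_def by auto

text \<open>Gaussianity and the covariance of white noise are prescribed on real test functions
  only; this identity carries them over to complex ones.\<close>

lemma distributions_Re_Im:
  assumes "u \<in> distributions" "f \<in> test_functions"
  shows "u f = u (\<lambda>x. complex_of_real (Re (f x))) + \<i> * u (\<lambda>x. complex_of_real (Im (f x)))"
proof -
  have "f = (\<lambda>x. 1 * complex_of_real (Re (f x)) + \<i> * complex_of_real (Im (f x)))"
    by (auto simp: complex_eq_iff)
  then show ?thesis
    using distributions_linear[OF assms(1), of "\<lambda>x. complex_of_real (Re (f x))"
        "\<lambda>x. complex_of_real (Im (f x))" 1 "\<i>"] real_test_function_Re_Im[OF assms(2)]
    unfolding real_test_functions_def by (metis (no_types, lifting) mem_Collect_eq mult_1)
qed

subsection \<open>Wavelets on regular ultrametric spaces\<close>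

lemma wavelet_space_vanishes:
  fixes \<nu> :: "'a::metric_space measure"
  assumes "f \<in> wavelet_space \<nu> I" "x \<notin> I"
  shows "f x = 0"
proof -
  obtain c where "f = (\<lambda>x. \<Sum>K\<in>maximal_subballs I. c K * indicator K x)"
    using assms(1) unfolding wavelet_space_def by blast
  then show ?thesis
    using assms(2)
    by (auto intro!: sum.neutral simp: maximal_subballs_def maximal_subball_def indicator_def)
qed

context
  fixes X :: "'a::metric_space itself"
  assumes ru: "regular_ultrametric_space X"
begin

text \<open>Every point of an ultrametric ball is a centre of it, and positive diameter excludes
  radius 0, so the open ball of the same radius fits inside.\<close>

lemma internal_vertex_open:
  fixes I :: "'a set"
  assumes "I \<in> internal_vertices"
  shows "open I"
  unfolding open_contains_ball
proof
  fix x assume x: "x \<in> I"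
  obtain r where r: "0 \<le> r" "I = cball x r"
    using is_ball_at[OF ru internal_is_ball[OF ru assms] x] .
  have "r \<noteq> 0" using assms r unfolding internal_vertices_def by auto
  then show "\<exists>e>0. ball x e \<subseteq> I" using r by (intro exI[of _ r]) auto
qed

text \<open>\<open>K\<close> may be a single point, so no radius argument is available. Instead,
  \<open>K\<close> is what remains of the open ball \<open>I\<close> after removing its other
  maximal subballs, which are finitely many closed sets.\<close>

lemma maximal_subball_open:
  fixes I K :: "'a set"
  assumes I: "I \<in> internal_vertices" and K: "maximal_subball K I"
  shows "open K"
proof -
  have cl: "closed (\<Union>(maximal_subballs I - {K}))"
    using finite_maximal_subballs[OF ru I]
    by (intro closed_Union) (auto simp: maximal_subballs_def maximal_subball_def is_ball_def)
  have "K = I - \<Union>(maximal_subballs I - {K})"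
  proof (intro equalityI subsetI)
    fix x assume x: "x \<in> K"
    then show "x \<in> I - \<Union>(maximal_subballs I - {K})"
      using maximal_subballD(3)[OF ru K] maximal_subball_unique[OF ru _ K _ x]
      unfolding maximal_subballs_def by auto
  next
    fix x assume x: "x \<in> I - \<Union>(maximal_subballs I - {K})"
    then obtain L where "maximal_subball L I" "x \<in> L" using maximal_subball_ex[OF ru I, of x] by auto
    then show "x \<in> K" using x unfolding maximal_subballs_def by auto
  qed
  then show ?thesis using cl internal_vertex_open[OF I] open_Diff by metis
qed

text \<open>Total boundedness follows by descent: a ball without a finite
  \<open>\<epsilon>\<close>-net has a maximal subball without one, since there are finitely many
  subballs to cover it. Iteration gives a strictly decreasing sequence of such balls, whose
  diameters tend to zero, yet a ball of diameter below \<open>\<epsilon>\<close> is covered by one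
  open ball.\<close>

lemma is_ball_compact:
  fixes I :: "'a set"
  assumes "is_ball I"
  shows "compact I"
  unfolding compact_eq_totally_bounded
proof (intro conjI allI impI)
  have "closed I" using assms unfolding is_ball_def by auto
  then show "uniform_space_class.complete I"
    using complete_closed_subset[of I UNIV] ru unfolding regular_ultrametric_space_def by auto
next
  fix \<epsilon> :: real assume \<epsilon>: "0 < \<epsilon>"
  define bad where "bad V \<longleftrightarrow> \<not> (\<exists>k. finite k \<and> V \<subseteq> (\<Union>x\<in>k. ball x \<epsilon>))" for V :: "'a set"
  have one: "\<not> bad V" if "V \<subseteq> ball x \<epsilon>" for V x
    unfolding bad_def using that by (auto intro!: exI[of _ "{x}"])
  have step: "\<exists>W. (is_ball W \<and> bad W) \<and> W \<subset> V" if V: "is_ball V" "bad V" for V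
  proof -
    obtain x where x: "x \<in> V" using is_ball_nonempty[OF ru V(1)] by auto
    \<comment> \<open>A bad ball cannot be a point, hence it is an internal vertex and decomposes
      into finitely many maximal subballs.\<close>
    have "\<not> V \<subseteq> {x}" using one[of V x] V(2) \<epsilon> subset_trans[of V "{x}" "ball x \<epsilon>"] by auto
    then obtain y where "y \<in> V" "x \<noteq> y" by auto
    then have "V \<in> internal_vertices" using is_ball_internal[OF ru V(1) x] by auto
    then obtain S where S: "finite S" "\<forall>K\<in>S. maximal_subball K V" "V = \<Union>S"
      by (rule finite_subballs[OF ru])
    have "\<exists>W\<in>S. bad W"
    proof (rule ccontr)
      assume "\<not> ?thesis"
      then have "\<forall>W\<in>S. \<exists>k. finite k \<and> W \<subseteq> (\<Union>x\<in>k. ball x \<epsilon>)" unfolding bad_def by blast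
      then obtain k where k: "\<And>W. W \<in> S \<Longrightarrow> finite (k W) \<and> W \<subseteq> (\<Union>x\<in>k W. ball x \<epsilon>)" by metis
      then have "V \<subseteq> (\<Union>x\<in>(\<Union>W\<in>S. k W). ball x \<epsilon>)" unfolding S(3)
      proof (intro Union_least)
        fix W assume W: "W \<in> S"
        then have "W \<subseteq> (\<Union>x\<in>k W. ball x \<epsilon>)" using k by simp
        also have "\<dots> \<subseteq> (\<Union>x\<in>(\<Union>W\<in>S. k W). ball x \<epsilon>)" using W by (intro UN_mono) auto
        finally show "W \<subseteq> (\<Union>x\<in>(\<Union>W\<in>S. k W). ball x \<epsilon>)" .
      qed
      moreover have "finite (\<Union>W\<in>S. k W)" using S(1) k by auto
      ultimately show False using V(2) unfolding bad_def by blast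
    qed
    then show ?thesis using S(2) unfolding maximal_subball_def by blast
  qed
  have "\<not> bad I"
  proof
    assume "bad I"
    have "\<exists>B. \<forall>n. (is_ball (B n) \<and> bad (B n)) \<and> B (Suc n) \<subset> B n"
    proof (rule dependent_nat_choice[where Q = "\<lambda>_ V W. W \<subset> V"])
      show "\<exists>V. is_ball V \<and> bad V" using assms \<open>bad I\<close> by (intro exI conjI)
      show "\<exists>W. (is_ball W \<and> bad W) \<and> W \<subset> V" if "is_ball V \<and> bad V" for V
        using step[of V] that by simp
    qed
    then obtain B where "\<forall>n. (is_ball (B n) \<and> bad (B n)) \<and> B (Suc n) \<subset> B n" by (elim exE)
    then have B: "is_ball (B n)" "bad (B n)" "B (Suc n) \<subset> B n" for n by simp_all
    have "(\<lambda>n. diameter (B n)) \<longlonglongrightarrow> 0" by (intro decreasing_balls[OF ru] B)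
    from order_tendstoD(2)[OF this \<epsilon>] obtain n where n: "diameter (B n) < \<epsilon>"
      unfolding eventually_sequentially by (elim exE) auto
    obtain x where x: "x \<in> B n" using is_ball_nonempty[OF ru B(1)] by blast
    have "bounded (B n)" using B(1)[of n] unfolding is_ball_def by auto
    have "B n \<subseteq> ball x \<epsilon>"
    proof
      fix y assume "y \<in> B n"
      then have "dist x y \<le> diameter (B n)"
        using diameter_bounded_bound[OF \<open>bounded (B n)\<close> x] by simp
      then show "y \<in> ball x \<epsilon>" using n by simp
    qed
    then show False using one[of "B n" x] B(2)[of n] by simp
  qed
  then show "\<exists>k. finite k \<and> I \<subseteq> (\<Union>x\<in>k. ball x \<epsilon>)" unfolding bad_def by blast
qed

lemma wavelet_space_constant_on_subball:
  fixes \<nu> :: "'a measure"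
  assumes I: "I \<in> internal_vertices" and f: "f \<in> wavelet_space \<nu> I" and K: "maximal_subball K I"
  shows "f constant_on K"
proof -
  obtain c where fc: "f = (\<lambda>x. \<Sum>K\<in>maximal_subballs I. c K * indicator K x)"
    using f unfolding wavelet_space_def by blast
  have "f y = c K" if "y \<in> K" for y
  proof -
    have "f y = (\<Sum>L\<in>maximal_subballs I. if L = K then c K else 0)"
      unfolding fc using that maximal_subball_unique[OF ru] K
      by (intro sum.cong) (auto simp: maximal_subballs_def indicator_def)
    also have "\<dots> = c K"
      using finite_maximal_subballs[OF ru I] K by (simp add: maximal_subballs_def)
    finally show ?thesis .
  qed
  then show ?thesis unfolding constant_on_def by blast
qed

text \<open>Intersecting balls are nested, so \<open>B\<close> either misses \<open>I\<close> or
  lies strictly inside it; in the second case maximality puts \<open>B\<close> within one maximal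
  subball.\<close>

lemma wavelet_space_constant_on_ball:
  fixes \<nu> :: "'a measure"
  assumes I: "I \<in> internal_vertices" and f: "f \<in> wavelet_space \<nu> I"
    and B: "is_ball B" "\<not> I \<subseteq> B"
  shows "f constant_on B"
proof (cases "B \<inter> I = {}")
  case True
  then show ?thesis using wavelet_space_vanishes[OF f] unfolding constant_on_def by blast
next
  case False
  then obtain x where x: "x \<in> B" "x \<in> I" by auto
  obtain K where K: "maximal_subball K I" "x \<in> K" using maximal_subball_ex[OF ru I x(2)] .
  have BI: "B \<subset> I"
    using is_ball_linear[OF ru B(1) internal_is_ball[OF ru I] x] B(2) by auto
  have "B \<subseteq> K"
    using is_ball_linear[OF ru B(1) maximal_subballD(1)[OF ru K(1)] x(1) K(2)]
      maximal_subballD(4)[OF ru K(1) B(1) _ BI] by auto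
  then show ?thesis
    using wavelet_space_constant_on_subball[OF I f K(1)] constant_on_subset by blast
qed

text \<open>The maximal subballs of \<open>I\<close> and the complement of \<open>I\<close> are open
  and cover the space, and \<open>f\<close> is constant on each; compactness of \<open>I\<close>
  controls the support. White noise can thus be evaluated at wavelets.\<close>

lemma wavelet_space_test_function:
  fixes \<nu> :: "'a measure"
  assumes I: "I \<in> internal_vertices" and f: "f \<in> wavelet_space \<nu> I"
  shows "f \<in> test_functions"
  unfolding test_functions_def
proof (intro CollectI conjI allI)
  have cI: "compact I" using is_ball_compact internal_is_ball[OF ru I] by blast
  fix x
  show "\<exists>U. open U \<and> x \<in> U \<and> f constant_on U"
  proof (cases "x \<in> I")
    case True
    obtain K where K: "maximal_subball K I" "x \<in> K" using maximal_subball_ex[OF ru I True] .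
    then show ?thesis
      using maximal_subball_open[OF I] wavelet_space_constant_on_subball[OF I f] by blast
  next
    case False
    have "open (- I)" using compact_imp_closed[OF cI] by auto
    moreover have "f constant_on (- I)"
      using wavelet_space_vanishes[OF f] unfolding constant_on_def by blast
    ultimately show ?thesis using False by blast
  qed
  have "{x. f x \<noteq> 0} \<subseteq> I" using wavelet_space_vanishes[OF f] by blast
  then have "closure {x. f x \<noteq> 0} \<subseteq> I"
    using compact_imp_closed[OF cI] by (rule closure_minimal)
  then show "compact (closure {x. f x \<noteq> 0})"
    using cI by (metis closed_closure compact_Int_closed inf.absorb_iff2)
qed

text \<open>\<open>R\<close> supplies an internal vertex, hence two distinct points \<open>x\<close>
  and \<open>y\<close>. A radius of at least \<open>dist x y\<close> makes the ball around
  \<open>S\<close> nondegenerate, also when \<open>S\<close> is empty or a point.\<close>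

lemma bounded_subset_internal_vertex:
  fixes R S :: "'a set"
  assumes R: "R \<in> vertices" and S: "bounded S"
  obtains I where "I \<in> internal_vertices" "S \<subseteq> I"
proof -
  obtain J :: "'a set" where J: "J \<in> internal_vertices" using R unfolding vertices_def by blast
  obtain x where x: "x \<in> J" using is_ball_nonempty[OF ru internal_is_ball[OF ru J]] by auto
  have "\<not> J \<subseteq> {x}"
  proof
    assume "J \<subseteq> {x}"
    then have "J = {x}" using x by blast
    then show False using J by (simp add: internal_vertices_def)
  qed
  then obtain y where y: "y \<noteq> x" by blast
  obtain e where e: "\<forall>z\<in>S. dist x z \<le> e" using S bounded_any_center[of S x] by blast
  define I where "I = cball x (max e (dist x y))"
  have "is_ball I" unfolding is_ball_def I_def by (intro exI conjI) (auto simp: max.coboundedI2)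
  then have "I \<in> internal_vertices"
    using y by (intro is_ball_internal[OF ru, of I x y]) (auto simp: I_def max.coboundedI2)
  moreover have "S \<subseteq> I" unfolding I_def using e by (auto simp: max.coboundedI1)
  ultimately show ?thesis using that by blast
qed

text \<open>The compact support lies in one vertex of finite measure, and continuity bounds
  \<open>f\<close> there. Since non-integrable functions have integral 0 by convention, this is what
  makes a mean-zero assumption meaningful and lets it pass to real and imaginary parts.\<close>

lemma test_function_integrable:
  fixes \<nu> :: "'a measure" and R :: "'a set"
  assumes borel: "sets \<nu> = sets borel"
    and ball_measure: "\<And>I. I \<in> vertices \<Longrightarrow> 0 < emeasure \<nu> I \<and> emeasure \<nu> I < \<infinity>"
    and R: "R \<in> vertices"
    and f: "f \<in> test_functions"
  shows "integrable \<nu> f"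
proof -
  define S where "S = closure {x. f x \<noteq> 0}"
  have S: "compact S" using f unfolding S_def test_functions_def by auto
  have out: "f x = 0" if "x \<notin> S" for x using that closure_subset[of "{x. f x \<noteq> 0}"] unfolding S_def by auto
  obtain I where I: "I \<in> internal_vertices" "S \<subseteq> I"
    using bounded_subset_internal_vertex[OF R compact_imp_bounded[OF S]] .
  have "emeasure \<nu> S \<le> emeasure \<nu> I"
    using I internal_vertex_open[OF I(1)] borel by (intro emeasure_mono) auto
  also have "\<dots> < \<infinity>" using ball_measure internal_vertex[OF ru I(1)] by blast
  finally have fin: "emeasure \<nu> S < \<infinity>" .
  have "compact (f ` S)"
    using S continuous_on_subset[OF continuous_test_function[OF f]] by (intro compact_continuous_image) auto
  then obtain b where b: "\<And>x. x \<in> S \<Longrightarrow> norm (f x) \<le> b"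
    using compact_imp_bounded bounded_iff by (metis imageI)
  have m: "f \<in> borel_measurable \<nu>"
    using borel_measurable_continuous_onI[OF continuous_test_function[OF f]] measurable_cong_sets[OF borel refl] by blast
  have "S \<in> sets \<nu>" using borel_closed[OF compact_imp_closed[OF S]] borel by simp
  then show ?thesis
    using m fin b out
    by (intro integrableI_bounded_set[of S \<nu> f b]) auto
qed

end

subsection \<open>Gaussian fields\<close>

lemma gaussian_field_measurable:
  "gaussian_field M \<psi> \<Longrightarrow> f \<in> test_functions \<Longrightarrow> (\<lambda>\<omega>. \<psi> \<omega> f) \<in> borel_measurable M"
  unfolding gaussian_field_def random_field_def by blast

lemma gaussian_field_distributions:
  "gaussian_field M \<psi> \<Longrightarrow> \<omega> \<in> space M \<Longrightarrow> \<psi> \<omega> \<in> distributions"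
  unfolding gaussian_field_def random_field_def by blast

lemma gaussian_field_real:
  "gaussian_field M \<psi> \<Longrightarrow> \<omega> \<in> space M \<Longrightarrow> f \<in> real_test_functions \<Longrightarrow>
    complex_of_real (Re (\<psi> \<omega> f)) = \<psi> \<omega> f"
  unfolding gaussian_field_def random_field_def by (metis of_real_Re)

lemma gaussian_field_variable:
  assumes "gaussian_field M \<psi>" "f \<in> real_test_functions"
  shows "gaussian_variable M (\<lambda>\<omega>. Re (\<psi> \<omega> f))"
proof -
  have "\<forall>F c. finite F \<and> F \<subseteq> real_test_functions \<longrightarrow> gaussian_variable M (\<lambda>\<omega>. \<Sum>f\<in>F. c f * Re (\<psi> \<omega> f))"
    using assms(1) unfolding gaussian_field_def jointly_gaussian_def by blast
  from this[rule_format, of "{f}" "\<lambda>_. 1"] show ?thesis using assms(2) by simp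
qed

text \<open>Realness on real test functions makes the values at \<open>Re f\<close> and
  \<open>Im f\<close> the real and imaginary parts of the value at \<open>f\<close>, so the squared
  modulus is a sum of two Gaussian squares.\<close>

lemma (in prob_space) gaussian_field_square_integrable:
  assumes "gaussian_field M \<psi>" "f \<in> test_functions"
  shows "integrable M (\<lambda>\<omega>. (cmod (\<psi> \<omega> f))\<^sup>2)"
proof -
  let ?a = "\<lambda>x. complex_of_real (Re (f x))" and ?b = "\<lambda>x. complex_of_real (Im (f x))"
  have r: "?a \<in> real_test_functions" "?b \<in> real_test_functions"
    using real_test_function_Re_Im[OF assms(2)] .
  have i: "integrable M (\<lambda>\<omega>. (Re (\<psi> \<omega> ?a))\<^sup>2 + (Re (\<psi> \<omega> ?b))\<^sup>2)"
    using gaussian_variable_square_integrable[OF gaussian_field_variable[OF assms(1) r(1)]]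
      gaussian_variable_square_integrable[OF gaussian_field_variable[OF assms(1) r(2)]] by simp
  have "(cmod (\<psi> \<omega> f))\<^sup>2 = (Re (\<psi> \<omega> ?a))\<^sup>2 + (Re (\<psi> \<omega> ?b))\<^sup>2" if \<omega>: "\<omega> \<in> space M" for \<omega>
  proof -
    have "\<psi> \<omega> f = complex_of_real (Re (\<psi> \<omega> ?a)) + \<i> * complex_of_real (Re (\<psi> \<omega> ?b))"
      unfolding gaussian_field_real[OF assms(1) \<omega> r(1)] gaussian_field_real[OF assms(1) \<omega> r(2)]
      using distributions_Re_Im[OF gaussian_field_distributions[OF assms(1) \<omega>] assms(2)] .
    then show ?thesis by (simp add: cmod_power2)
  qed
  with i show ?thesis by (simp cong: Bochner_Integration.integrable_cong)
qed

lemma (in prob_space) gaussian_field_mult_integrable: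
  assumes "gaussian_field M \<psi>" "f \<in> test_functions" "g \<in> test_functions"
  shows "integrable M (\<lambda>\<omega>. \<psi> \<omega> f * \<psi> \<omega> g)"
  by (rule integrable_mult_of_square_integrable[OF gaussian_field_measurable[OF assms(1,2)]
      gaussian_field_measurable[OF assms(1,3)] gaussian_field_square_integrable[OF assms(1,2)]
      gaussian_field_square_integrable[OF assms(1,3)]])

lemma (in prob_space) gaussian_field_integrable:
  assumes "gaussian_field M \<psi>" "f \<in> test_functions"
  shows "integrable M (\<lambda>\<omega>. \<psi> \<omega> f)"
  using integrable_mult_of_square_integrable[OF gaussian_field_measurable[OF assms], of "\<lambda>_. 1"]
    gaussian_field_square_integrable[OF assms] by simp

section \<open>Mean and bilinear correlations of white noise\<close>

lemma (in prob_space) white_noise_mean: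
  assumes \<phi>: "white_noise M \<nu> \<phi>" and f: "f \<in> test_functions"
  shows "(\<integral>\<omega>. \<phi> \<omega> f \<partial>M) = 0"
proof -
  let ?a = "\<lambda>x. complex_of_real (Re (f x))" and ?b = "\<lambda>x. complex_of_real (Im (f x))"
  have g: "gaussian_field M \<phi>" using \<phi> unfolding white_noise_def by blast
  have r: "?a \<in> real_test_functions" "?b \<in> real_test_functions"
    using real_test_function_Re_Im[OF f] .
  then have t: "?a \<in> test_functions" "?b \<in> test_functions" unfolding real_test_functions_def by auto
  have "(\<integral>\<omega>. \<phi> \<omega> f \<partial>M) = (\<integral>\<omega>. \<phi> \<omega> ?a + \<i> * \<phi> \<omega> ?b \<partial>M)"
    using distributions_Re_Im[OF gaussian_field_distributions[OF g] f]
    by (intro Bochner_Integration.integral_cong) auto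
  also have "\<dots> = (\<integral>\<omega>. \<phi> \<omega> ?a \<partial>M) + \<i> * (\<integral>\<omega>. \<phi> \<omega> ?b \<partial>M)"
    using gaussian_field_integrable[OF g t(1)] gaussian_field_integrable[OF g t(2)] by simp
  also have "\<dots> = 0" using \<phi> r unfolding white_noise_def by simp
  finally show ?thesis .
qed

text \<open>On the support of \<open>f\<close> the function \<open>g\<close> is a constant
  \<open>c\<close>, so each of the four real covariances is \<open>c\<close> times a mean that
  vanishes.\<close>

lemma (in prob_space) white_noise_orthogonal:
  fixes \<nu> :: "'x::metric_space measure"
  assumes \<phi>: "white_noise M \<nu> \<phi>" and f: "f \<in> test_functions" and g: "g \<in> test_functions"
    and f_int: "integrable \<nu> f" "(\<integral>x. f x \<partial>\<nu>) = 0"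
    and f_supp: "\<And>x. x \<notin> B \<Longrightarrow> f x = 0" and g_const: "g constant_on B"
  shows "(\<integral>\<omega>. \<phi> \<omega> f * \<phi> \<omega> g \<partial>M) = 0"
proof -
  let ?re = "\<lambda>f x. complex_of_real (Re (f x))" and ?im = "\<lambda>f x. complex_of_real (Im (f x))"
  have G: "gaussian_field M \<phi>" using \<phi> unfolding white_noise_def by blast
  have r: "?re f \<in> real_test_functions" "?im f \<in> real_test_functions"
    "?re g \<in> real_test_functions" "?im g \<in> real_test_functions"
    using real_test_function_Re_Im f g by blast+
  then have t: "?re f \<in> test_functions" "?im f \<in> test_functions"
    "?re g \<in> test_functions" "?im g \<in> test_functions" unfolding real_test_functions_def by auto
  have z: "(\<integral>\<omega>. \<phi> \<omega> p * \<phi> \<omega> q \<partial>M) = 0"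
    if p: "p = ?re f \<or> p = ?im f" and q: "q = ?re g \<or> q = ?im g" for p q
  proof -
    \<comment> \<open>Integrability of \<open>f\<close> lets its vanishing integral split into real
      and imaginary parts.\<close>
    have p0: "(\<integral>x. p x \<partial>\<nu>) = 0" "\<And>x. x \<notin> B \<Longrightarrow> p x = 0"
      using p f_supp f_int by (auto simp: integral_Re integral_Im)
    obtain c where c: "\<And>x. x \<in> B \<Longrightarrow> q x = c" using q g_const unfolding constant_on_def by auto
    have "(\<integral>\<omega>. \<phi> \<omega> p * \<phi> \<omega> q \<partial>M) = (\<integral>x. p x * q x \<partial>\<nu>)"
      using \<phi> r p q unfolding white_noise_def by auto
    also have "(\<lambda>x. p x * q x) = (\<lambda>x. p x * c)"
    proof
      show "p x * q x = p x * c" for x using c[of x] p0(2)[of x] by (cases "x \<in> B") auto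
    qed
    also have "(\<integral>x. p x * c \<partial>\<nu>) = 0" using p0(1) by simp
    finally show ?thesis .
  qed
  have expand: "(a + \<i> * b) * (c + \<i> * d) = a * c + \<i> * (a * d) + \<i> * (b * c) - b * d" for a b c d
    by (simp add: complex_eq_iff algebra_simps)
  have "(\<integral>\<omega>. \<phi> \<omega> f * \<phi> \<omega> g \<partial>M) =
    (\<integral>\<omega>. \<phi> \<omega> (?re f) * \<phi> \<omega> (?re g) + \<i> * (\<phi> \<omega> (?re f) * \<phi> \<omega> (?im g)) +
      \<i> * (\<phi> \<omega> (?im f) * \<phi> \<omega> (?re g)) - \<phi> \<omega> (?im f) * \<phi> \<omega> (?im g) \<partial>M)"
  proof (rule Bochner_Integration.integral_cong[OF refl])
    fix \<omega> assume "\<omega> \<in> space M"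
    then have d: "\<phi> \<omega> \<in> distributions" by (rule gaussian_field_distributions[OF G])
    show "\<phi> \<omega> f * \<phi> \<omega> g = \<phi> \<omega> (?re f) * \<phi> \<omega> (?re g) + \<i> * (\<phi> \<omega> (?re f) * \<phi> \<omega> (?im g)) +
      \<i> * (\<phi> \<omega> (?im f) * \<phi> \<omega> (?re g)) - \<phi> \<omega> (?im f) * \<phi> \<omega> (?im g)"
      unfolding distributions_Re_Im[OF d f] distributions_Re_Im[OF d g]
      by (rule expand)
  qed
  also have "\<dots> = (\<integral>\<omega>. \<phi> \<omega> (?re f) * \<phi> \<omega> (?re g) \<partial>M) + \<i> * (\<integral>\<omega>. \<phi> \<omega> (?re f) * \<phi> \<omega> (?im g) \<partial>M) +
      \<i> * (\<integral>\<omega>. \<phi> \<omega> (?im f) * \<phi> \<omega> (?re g) \<partial>M) - (\<integral>\<omega>. \<phi> \<omega> (?im f) * \<phi> \<omega> (?im g) \<partial>M)"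
    using t gaussian_field_mult_integrable[OF G] by simp
  also have "\<dots> = 0" using z by simp
  finally show ?thesis .
qed

section \<open>From vanishing correlations to independent field values\<close>

lemma gaussian_field_add:
  assumes \<psi>: "gaussian_field M \<psi>" and fg: "f \<in> real_test_functions" "g \<in> real_test_functions"
  shows "gaussian_variable M (\<lambda>\<omega>. Re (\<psi> \<omega> f) + Re (\<psi> \<omega> g))"
proof -
  have *: "\<forall>F c. finite F \<and> F \<subseteq> real_test_functions \<longrightarrow> gaussian_variable M (\<lambda>\<omega>. \<Sum>f\<in>F. c f * Re (\<psi> \<omega> f))"
    using \<psi> unfolding gaussian_field_def jointly_gaussian_def by blast
  show ?thesis
  \<comment> \<open>\<open>jointly_gaussian\<close> sums over sets of test functions, so equal
    functions collapse to one element with coefficient 2.\<close>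
  proof (cases "f = g")
    case True
    then show ?thesis using *[rule_format, of "{f}" "\<lambda>_. 2"] fg by simp
  next
    case False
    then show ?thesis using *[rule_format, of "{f, g}" "\<lambda>_. 1"] fg by simp
  qed
qed

text \<open>For a field that is real on real test functions, the value here is s Re psi(f) + t Im
  psi(f). Linear functionals of the planar vector psi(f) thus become values of the field at real
  test functions that vanish wherever \<open>f\<close> does.\<close>

definition real_combination :: "real \<Rightarrow> real \<Rightarrow> ('a \<Rightarrow> complex) \<Rightarrow> 'a \<Rightarrow> complex"
  where "real_combination s t f x = complex_of_real (s * Re (f x) + t * Im (f x))"

lemma real_combination_real_test_function:
  "f \<in> test_functions \<Longrightarrow> real_combination s t f \<in> real_test_functions"
  using test_functions_comp[of f "\<lambda>z. complex_of_real (s * Re z + t * Im z)"]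
  unfolding real_test_functions_def real_combination_def[abs_def] by simp

lemma distributions_real_combination:
  assumes "u \<in> distributions" "f \<in> test_functions"
  shows "u (real_combination s t f) = complex_of_real s * u (\<lambda>x. complex_of_real (Re (f x))) +
    complex_of_real t * u (\<lambda>x. complex_of_real (Im (f x)))"
  using distributions_linear[OF assms(1), of "\<lambda>x. complex_of_real (Re (f x))"
      "\<lambda>x. complex_of_real (Im (f x))" "complex_of_real s" "complex_of_real t"]
    real_test_function_Re_Im[OF assms(2)]
  unfolding real_test_functions_def real_combination_def[abs_def] by simp

lemma real_combination_mean_zero:
  assumes "integrable \<nu> f" "(\<integral>x. f x \<partial>\<nu>) = 0"
  shows "(\<integral>x. real_combination s t f x \<partial>\<nu>) = 0"
  using assms unfolding real_combination_def[abs_def] by (simp add: integral_Re integral_Im)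

text \<open>Each frequency vector of the four real variables Re psi(f), Im psi(f), Re psi(g), Im
  psi(g) selects one real combination of \<open>f\<close> and one of \<open>g\<close>. Their field
  values are uncorrelated with a Gaussian sum, so the joint characteristic function
  factorizes.\<close>

lemma (in prob_space) gaussian_field_indep_var:
  fixes f g :: "'x::metric_space \<Rightarrow> complex"
  assumes \<psi>: "gaussian_field M \<psi>" and f: "f \<in> test_functions" and g: "g \<in> test_functions"
    and mean: "\<And>h. h \<in> test_functions \<Longrightarrow> (\<integral>\<omega>. \<psi> \<omega> h \<partial>M) = 0"
    and uncorrelated: "\<And>s1 s2 t1 t2.
      (\<integral>\<omega>. \<psi> \<omega> (real_combination s1 s2 f) * \<psi> \<omega> (real_combination t1 t2 g) \<partial>M) = 0"
  shows "indep_var borel (\<lambda>\<omega>. \<psi> \<omega> f) borel (\<lambda>\<omega>. \<psi> \<omega> g)"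
proof -
  define U where "U h \<omega> = Re (\<psi> \<omega> (\<lambda>x. complex_of_real (Re (h x))))" for h \<omega>
  define V where "V h \<omega> = Re (\<psi> \<omega> (\<lambda>x. complex_of_real (Im (h x))))" for h \<omega>
  have UV: "\<psi> \<omega> (real_combination s t h) = complex_of_real (s * U h \<omega> + t * V h \<omega>)"
    "\<psi> \<omega> h = Complex (U h \<omega>) (V h \<omega>)"
    if "h \<in> test_functions" "\<omega> \<in> space M" for h \<omega> s t
    using distributions_real_combination[OF gaussian_field_distributions[OF \<psi> that(2)] that(1)]
      distributions_Re_Im[OF gaussian_field_distributions[OF \<psi> that(2)] that(1)]
      gaussian_field_real[OF \<psi> that(2)] real_test_function_Re_Im[OF that(1)]
    unfolding U_def V_def by (simp_all add: Complex_eq)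
  have meas: "U h \<in> borel_measurable M" "V h \<in> borel_measurable M" if "h \<in> test_functions" for h
    using gaussian_field_variable[OF \<psi>] real_test_function_Re_Im[OF that]
    unfolding U_def[abs_def] V_def[abs_def] gaussian_variable_def by auto
  have [measurable]: "(\<lambda>(a, b). Complex a b) \<in> borel_measurable (borel \<Otimes>\<^sub>M borel)"
    unfolding Complex_eq case_prod_beta by measurable
  have "indep_var (borel \<Otimes>\<^sub>M borel) (\<lambda>\<omega>. (U f \<omega>, V f \<omega>)) (borel \<Otimes>\<^sub>M borel) (\<lambda>\<omega>. (U g \<omega>, V g \<omega>))"
  proof (rule indep_var_pairs_iexp)
    fix s1 s2 t1 t2
    define X where "X \<omega> = Re (\<psi> \<omega> (real_combination s1 s2 f))" for \<omega>
    define Y where "Y \<omega> = Re (\<psi> \<omega> (real_combination t1 t2 g))" for \<omega>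
    have r: "real_combination s1 s2 f \<in> real_test_functions" "real_combination t1 t2 g \<in> real_test_functions"
      using f g real_combination_real_test_function by auto
    then have t: "real_combination s1 s2 f \<in> test_functions" "real_combination t1 t2 g \<in> test_functions"
      unfolding real_test_functions_def by auto
    have m: "(\<integral>\<omega>. Re (\<psi> \<omega> h) \<partial>M) = 0" if "h \<in> test_functions" for h
      using mean[OF that] gaussian_field_integrable[OF \<psi> that] by simp
    have "complex_of_real (\<integral>\<omega>. X \<omega> * Y \<omega> \<partial>M) = (\<integral>\<omega>. complex_of_real (X \<omega> * Y \<omega>) \<partial>M)"
      by (rule integral_complex_of_real[symmetric])
    also have "\<dots> = (\<integral>\<omega>. \<psi> \<omega> (real_combination s1 s2 f) * \<psi> \<omega> (real_combination t1 t2 g) \<partial>M)"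
      using gaussian_field_real[OF \<psi> _ r(1)] gaussian_field_real[OF \<psi> _ r(2)]
      by (intro Bochner_Integration.integral_cong) (simp_all add: X_def Y_def)
    also have "\<dots> = 0" by (rule uncorrelated)
    finally have XY: "(\<integral>\<omega>. X \<omega> * Y \<omega> \<partial>M) = 0" by simp
    have "(\<integral>\<omega>. iexp (X \<omega>) * iexp (Y \<omega>) \<partial>M) = (\<integral>\<omega>. iexp (X \<omega>) \<partial>M) * (\<integral>\<omega>. iexp (Y \<omega>) \<partial>M)"
      using XY m[OF t(1)] m[OF t(2)] gaussian_field_variable[OF \<psi> r(1)]
        gaussian_field_variable[OF \<psi> r(2)] gaussian_field_add[OF \<psi> r]
      unfolding X_def[abs_def] Y_def[abs_def] by (intro gaussian_uncorrelated_iexp)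
    then show "(\<integral>\<omega>. iexp (s1 * U f \<omega> + s2 * V f \<omega>) * iexp (t1 * U g \<omega> + t2 * V g \<omega>) \<partial>M) =
      (\<integral>\<omega>. iexp (s1 * U f \<omega> + s2 * V f \<omega>) \<partial>M) * (\<integral>\<omega>. iexp (t1 * U g \<omega> + t2 * V g \<omega>) \<partial>M)"
      unfolding X_def[abs_def] Y_def[abs_def] using UV(1)[OF f] UV(1)[OF g]
      by (simp cong: Bochner_Integration.integral_cong)
  qed (use meas f g in auto)
  then have "indep_var borel ((\<lambda>(a, b). Complex a b) \<circ> (\<lambda>\<omega>. (U f \<omega>, V f \<omega>)))
      borel ((\<lambda>(a, b). Complex a b) \<circ> (\<lambda>\<omega>. (U g \<omega>, V g \<omega>)))"
    by (rule indep_var_compose) measurable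
  then show ?thesis
    by (rule indep_var_cong_space) (simp_all add: UV(2) f g)
qed

subsection \<open>The solution field\<close>

text \<open>Partial sum of the inverse operator applied to \<open>f\<close>, expanded in the
  conjugate wavelets: the coefficient of \<open>f\<close> against a conjugate wavelet is the
  integral of \<open>\<Psi>\<close> times \<open>f\<close>. Conjugates appear because d = phi(cnj
  Psi); thus \<open>\<phi>\<close> at this function is the partial sum of the series for
  \<open>\<psi>\<close> at \<open>f\<close>.\<close>

definition wavelet_partial_sum ::
    "'a::metric_space measure \<Rightarrow> ('a set \<Rightarrow> nat \<Rightarrow> 'a \<Rightarrow> complex) \<Rightarrow> ('a set \<Rightarrow> real) \<Rightarrow>
     ('a set \<times> nat) set \<Rightarrow> ('a \<Rightarrow> complex) \<Rightarrow> 'a \<Rightarrow> complex"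
  where "wavelet_partial_sum \<nu> \<Psi> lam F f = (\<lambda>x. \<Sum>p\<in>F.
    (complex_of_real (inverse (lam (fst p))) * (\<integral>x. \<Psi> (fst p) (snd p) x * f x \<partial>\<nu>)) *
      cnj (\<Psi> (fst p) (snd p) x))"

context
  fixes X :: "'a::metric_space itself"
    and \<nu> :: "'a measure" and \<Psi> :: "'a set \<Rightarrow> nat \<Rightarrow> 'a \<Rightarrow> complex"
  assumes ru: "regular_ultrametric_space X"
    and wavelets: "wavelet_system \<nu> \<Psi>"
begin

lemma wavelet:
  assumes "p \<in> wavelet_index"
  shows "fst p \<in> internal_vertices" "\<Psi> (fst p) (snd p) \<in> wavelet_space \<nu> (fst p)"
  using assms wavelets unfolding wavelet_index_def wavelet_system_def by auto

lemma cnj_wavelet_test_function: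
  assumes "p \<in> wavelet_index"
  shows "(\<lambda>x. cnj (\<Psi> (fst p) (snd p) x)) \<in> test_functions"
  using wavelet_space_test_function[OF ru wavelet[OF assms]] by (rule test_functions_comp) simp

lemma wavelet_partial_sum_test_function:
  assumes "F \<subseteq> wavelet_index"
  shows "wavelet_partial_sum \<nu> \<Psi> lam F f \<in> test_functions"
  unfolding wavelet_partial_sum_def using assms cnj_wavelet_test_function
  by (intro test_functions_sum) blast

lemma distributions_wavelet_partial_sum:
  assumes "u \<in> distributions" "F \<subseteq> wavelet_index"
  shows "u (wavelet_partial_sum \<nu> \<Psi> lam F f) =
    (\<Sum>(I, j)\<in>F. complex_of_real (inverse (lam I)) * u (\<lambda>x. cnj (\<Psi> I j x)) * (\<integral>x. \<Psi> I j x * f x \<partial>\<nu>))"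
proof -
  have "u (wavelet_partial_sum \<nu> \<Psi> lam F f) = (\<Sum>p\<in>F.
    (complex_of_real (inverse (lam (fst p))) * (\<integral>x. \<Psi> (fst p) (snd p) x * f x \<partial>\<nu>)) *
      u (\<lambda>x. cnj (\<Psi> (fst p) (snd p) x)))"
    unfolding wavelet_partial_sum_def using assms(2) cnj_wavelet_test_function
    by (intro distributions_sum[OF assms(1)]) blast
  then show ?thesis by (simp add: case_prod_beta ac_simps)
qed

lemma wavelet_coefficient_mean_zero:
  assumes p: "p \<in> wavelet_index" and B: "is_ball B" "\<not> fst p \<subseteq> B"
    and f: "{x. f x \<noteq> 0} \<subseteq> B" "(\<integral>x. f x \<partial>\<nu>) = 0"
  shows "(\<integral>x. \<Psi> (fst p) (snd p) x * f x \<partial>\<nu>) = 0"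
proof -
  obtain c where c: "\<And>x. x \<in> B \<Longrightarrow> \<Psi> (fst p) (snd p) x = c"
    using wavelet_space_constant_on_ball[OF ru wavelet[OF p] B] unfolding constant_on_def by blast
  have "(\<lambda>x. \<Psi> (fst p) (snd p) x * f x) = (\<lambda>x. c * f x)"
  proof
    show "\<Psi> (fst p) (snd p) x * f x = c * f x" for x using c[of x] f(1) by (cases "x \<in> B") auto
  qed
  then show ?thesis using f(2) by simp
qed

lemma wavelet_partial_sum_vanishes:
  assumes F: "F \<subseteq> wavelet_index" and B: "is_ball B"
    and f: "{x. f x \<noteq> 0} \<subseteq> B" "(\<integral>x. f x \<partial>\<nu>) = 0" and x: "x \<notin> B"
  shows "wavelet_partial_sum \<nu> \<Psi> lam F f x = 0"
  unfolding wavelet_partial_sum_def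
proof (rule sum.neutral, rule ballI)
  fix p assume "p \<in> F"
  then have p: "p \<in> wavelet_index" using F by auto
  show "(complex_of_real (inverse (lam (fst p))) * (\<integral>x. \<Psi> (fst p) (snd p) x * f x \<partial>\<nu>)) *
      cnj (\<Psi> (fst p) (snd p) x) = 0"
  proof (cases "fst p \<subseteq> B")
    case True
    then show ?thesis using wavelet_space_vanishes[OF wavelet(2)[OF p], of x] x by auto
  next
    case False
    then show ?thesis using wavelet_coefficient_mean_zero[OF p B False f] by simp
  qed
qed

lemma wavelet_partial_sum_mean:
  assumes F: "F \<subseteq> wavelet_index"
    and int: "\<And>h. h \<in> test_functions \<Longrightarrow> integrable \<nu> h"
  shows "(\<integral>x. wavelet_partial_sum \<nu> \<Psi> lam F f x \<partial>\<nu>) = 0"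
proof -
  have i: "integrable \<nu> (\<lambda>x. cnj (\<Psi> (fst p) (snd p) x))" if "p \<in> F" for p
    using int cnj_wavelet_test_function F that by blast
  have z: "(\<integral>x. cnj (\<Psi> (fst p) (snd p) x) \<partial>\<nu>) = 0" if "p \<in> F" for p
  proof -
    have "p \<in> wavelet_index" using F that by blast
    note w = wavelet[OF this]
    have "(\<integral>x. cnj (\<Psi> (fst p) (snd p) x) \<partial>\<nu>) = cnj (\<integral>x. \<Psi> (fst p) (snd p) x \<partial>\<nu>)"
      using int[OF wavelet_space_test_function[OF ru w]] by (intro integral_bounded_linear bounded_linear_cnj)
    then show ?thesis using w(2) unfolding wavelet_space_def by simp
  qed
  show ?thesis
    unfolding wavelet_partial_sum_def using i z by (subst Bochner_Integration.integral_sum) auto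
qed

lemma wavelet_partial_sum_constant:
  assumes F: "F \<subseteq> wavelet_index" and B: "is_ball B" "is_ball J" "B \<inter> J = {}"
    and g: "{x. g x \<noteq> 0} \<subseteq> J"
  shows "wavelet_partial_sum \<nu> \<Psi> lam F g constant_on B"
proof -
  define t where "t p x = (complex_of_real (inverse (lam (fst p))) *
    (\<integral>x. \<Psi> (fst p) (snd p) x * g x \<partial>\<nu>)) * cnj (\<Psi> (fst p) (snd p) x)" for p x
  have "\<exists>c. \<forall>x\<in>B. t p x = c" if "p \<in> F" for p
  proof (cases "fst p \<subseteq> B")
    case True
    have p: "p \<in> wavelet_index" using F that by blast
    have "\<Psi> (fst p) (snd p) x * g x = 0" for x
      using wavelet_space_vanishes[OF wavelet(2)[OF p], of x] True g B(3) by auto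
    then have "(\<integral>x. \<Psi> (fst p) (snd p) x * g x \<partial>\<nu>) = 0"
      by (simp only: Bochner_Integration.integral_zero)
    then have "t p x = 0" for x unfolding t_def by simp
    then show ?thesis by blast
  next
    case False
    have p: "p \<in> wavelet_index" using F that by blast
    \<comment> \<open>The coefficient against \<open>g\<close> may be nonzero here, but the wavelet
      is constant on \<open>B\<close>, so it contributes a constant.\<close>
    obtain c where "\<And>x. x \<in> B \<Longrightarrow> \<Psi> (fst p) (snd p) x = c"
      using wavelet_space_constant_on_ball[OF ru wavelet[OF p] B(1) False] unfolding constant_on_def by blast
    then have "t p x = complex_of_real (inverse (lam (fst p))) *
      (\<integral>x. \<Psi> (fst p) (snd p) x * g x \<partial>\<nu>) * cnj c" if "x \<in> B" for x
      unfolding t_def using that by simp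
    then show ?thesis by blast
  qed
  then have "\<forall>p\<in>F. \<exists>c. \<forall>x\<in>B. t p x = c" by blast
  from bchoice[OF this] obtain c where "\<And>p x. p \<in> F \<Longrightarrow> x \<in> B \<Longrightarrow> t p x = c p" by blast
  then have "wavelet_partial_sum \<nu> \<Psi> lam F g x = sum c F" if "x \<in> B" for x
    using that unfolding wavelet_partial_sum_def t_def by (intro sum.cong) auto
  then show ?thesis unfolding constant_on_def by blast
qed

section \<open>Passage from the partial sums to the solution field\<close>

context
  fixes M :: "'w measure" and \<phi> \<psi> :: "'w \<Rightarrow> ('a \<Rightarrow> complex) \<Rightarrow> complex"
    and lam :: "'a set \<Rightarrow> real" and A :: "('a \<Rightarrow> complex) \<Rightarrow> 'a \<Rightarrow> complex"
  assumes prob: "prob_space M"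
    and noise: "white_noise M \<nu> \<phi>"
    and gaussian: "gaussian_field M \<psi>"
    and solution: "field_solution M \<nu> \<Psi> lam A \<phi> \<psi>"
begin

interpretation prob_space M by (rule prob)

lemma noise_gaussian: "gaussian_field M \<phi>"
  using noise unfolding white_noise_def by blast

lemma field_solution_limit:
  assumes f: "f \<in> test_functions"
  shows "((\<lambda>F. \<integral>\<^sup>+\<omega>. ennreal ((cmod (\<psi> \<omega> f - \<phi> \<omega> (wavelet_partial_sum \<nu> \<Psi> lam F f)))\<^sup>2) \<partial>M) \<longlongrightarrow> 0)
    (finite_subsets_at_top wavelet_index)"
proof -
  have "((\<lambda>F. \<integral>\<^sup>+\<omega>. ennreal ((cmod (\<psi> \<omega> f -
            (\<Sum>(I, j)\<in>F. complex_of_real (inverse (lam I)) * \<phi> \<omega> (\<lambda>x. cnj (\<Psi> I j x)) *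
              (\<integral>x. \<Psi> I j x * f x \<partial>\<nu>))))\<^sup>2) \<partial>M) \<longlongrightarrow> 0)
        (finite_subsets_at_top wavelet_index)"
    using solution f unfolding field_solution_def by blast
  then show ?thesis
  proof (rule Lim_transform_eventually)
    show "\<forall>\<^sub>F F in finite_subsets_at_top wavelet_index.
      (\<integral>\<^sup>+\<omega>. ennreal ((cmod (\<psi> \<omega> f -
            (\<Sum>(I, j)\<in>F. complex_of_real (inverse (lam I)) * \<phi> \<omega> (\<lambda>x. cnj (\<Psi> I j x)) *
              (\<integral>x. \<Psi> I j x * f x \<partial>\<nu>))))\<^sup>2) \<partial>M) =
      (\<integral>\<^sup>+\<omega>. ennreal ((cmod (\<psi> \<omega> f - \<phi> \<omega> (wavelet_partial_sum \<nu> \<Psi> lam F f)))\<^sup>2) \<partial>M)"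
      by (intro eventually_finite_subsets_at_top_weakI nn_integral_cong)
        (simp only: distributions_wavelet_partial_sum[OF gaussian_field_distributions[OF noise_gaussian]])
  qed
qed

lemma field_solution_approximants_measurable:
  "\<forall>\<^sub>F F in finite_subsets_at_top wavelet_index. (\<lambda>\<omega>. \<phi> \<omega> (wavelet_partial_sum \<nu> \<Psi> lam F f)) \<in> borel_measurable M"
  by (intro eventually_finite_subsets_at_top_weakI gaussian_field_measurable[OF noise_gaussian]
      wavelet_partial_sum_test_function)

lemma field_solution_mean:
  assumes f: "f \<in> test_functions"
  shows "(\<integral>\<omega>. \<psi> \<omega> f \<partial>M) = 0"
proof -
  \<comment> \<open>The mean is the correlation with the constant 1, which is its own approximant,
    so the limit lemma covers this case too.\<close>
  have "(\<integral>\<omega>. \<psi> \<omega> f * 1 \<partial>M) = 0"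
  proof (rule L2_limit_orthogonal[OF _ _ field_solution_approximants_measurable[of f] _ _ _
      field_solution_limit[OF f], where YF = "\<lambda>_ _. 1"])
    show "\<forall>\<^sub>F F in finite_subsets_at_top wavelet_index. (\<integral>\<omega>. \<phi> \<omega> (wavelet_partial_sum \<nu> \<Psi> lam F f) * 1 \<partial>M) = 0"
      using white_noise_mean[OF noise wavelet_partial_sum_test_function]
      by (intro eventually_finite_subsets_at_top_weakI) simp
  qed (use gaussian_field_measurable[OF gaussian f] gaussian_field_square_integrable[OF gaussian f] in
      \<open>auto simp: finite_subsets_at_top_neq_bot\<close>)
  then show ?thesis by simp
qed

lemma field_solution_uncorrelated:
  assumes int: "\<And>h. h \<in> test_functions \<Longrightarrow> integrable \<nu> h"
    and ball: "is_ball I" "is_ball J" "I \<inter> J = {}"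
    and f: "f \<in> test_functions" "{x. f x \<noteq> 0} \<subseteq> I" "(\<integral>x. f x \<partial>\<nu>) = 0"
    and g: "g \<in> test_functions" "{x. g x \<noteq> 0} \<subseteq> J"
  shows "(\<integral>\<omega>. \<psi> \<omega> f * \<psi> \<omega> g \<partial>M) = 0"
proof (rule L2_limit_orthogonal[OF _ _ field_solution_approximants_measurable
      field_solution_approximants_measurable _ _ field_solution_limit[OF f(1)] field_solution_limit[OF g(1)]])
  show "\<forall>\<^sub>F F in finite_subsets_at_top wavelet_index.
    (\<integral>\<omega>. \<phi> \<omega> (wavelet_partial_sum \<nu> \<Psi> lam F f) * \<phi> \<omega> (wavelet_partial_sum \<nu> \<Psi> lam F g) \<partial>M) = 0"
  proof (rule eventually_finite_subsets_at_top_weakI)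
    fix F :: "('a set \<times> nat) set" assume F: "F \<subseteq> wavelet_index"
    show "(\<integral>\<omega>. \<phi> \<omega> (wavelet_partial_sum \<nu> \<Psi> lam F f) * \<phi> \<omega> (wavelet_partial_sum \<nu> \<Psi> lam F g) \<partial>M) = 0"
      using wavelet_partial_sum_test_function[OF F] int wavelet_partial_sum_mean[OF F int]
        wavelet_partial_sum_vanishes[OF F ball(1) f(2,3)] wavelet_partial_sum_constant[OF F ball g(2)]
      by (intro white_noise_orthogonal[OF noise, where B = I]) auto
  qed
qed (use gaussian_field_measurable[OF gaussian] gaussian_field_square_integrable[OF gaussian] f(1) g(1) in
    \<open>auto simp: finite_subsets_at_top_neq_bot\<close>)

end

end

theorem theorem17:
  fixes \<nu> :: "'a::metric_space measure"
    and T :: "'a set \<Rightarrow> real"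
    and R :: "'a set"
    and \<Psi> :: "'a set \<Rightarrow> nat \<Rightarrow> 'a \<Rightarrow> complex"
    and M :: "'w measure"
    and \<phi> \<psi> :: "'w \<Rightarrow> ('a \<Rightarrow> complex) \<Rightarrow> complex"
  assumes space: "regular_ultrametric_space TYPE('a)"
    and borel: "sets \<nu> = sets borel"
    and ball_measure: "\<And>I. I \<in> vertices \<Longrightarrow> 0 < emeasure \<nu> I \<and> emeasure \<nu> I < \<infinity>"
    and T_nonneg: "\<And>I. I \<in> vertices \<Longrightarrow> 0 \<le> T I"
    and T_positive: "\<And>I. I \<in> internal_vertices \<Longrightarrow> 0 < eigval \<nu> T I"
    and R: "R \<in> vertices"
    and convergence1: "(\<lambda>J. T J * (measure \<nu> J - measure \<nu> (pred_ball J R))) summable_on vertices_above R"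
    and convergence2: "(\<lambda>I. inverse ((eigval \<nu> T I)\<^sup>2) *
        (inverse (measure \<nu> (pred_ball I R)) - inverse (measure \<nu> I))) summable_on vertices_above R"
    and wavelets: "wavelet_system \<nu> \<Psi>"
    and prob: "prob_space M"
    and noise: "white_noise M \<nu> \<phi>"
    and gaussian: "gaussian_field M \<psi>"
    and solution: "field_solution M \<nu> \<Psi> (eigval \<nu> T) (pseudodiff \<nu> T) \<phi> \<psi>"
  shows "ultrametric_markovian M \<nu> \<psi>"
proof -
  interpret prob_space M by (rule prob)
  have int: "integrable \<nu> h" if "h \<in> test_functions" for h
    using test_function_integrable[OF space borel ball_measure R that] .
  note mean = field_solution_mean[OF space wavelets prob noise gaussian solution]
  note uncorrelated = field_solution_uncorrelated[OF space wavelets prob noise gaussian solution int]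
  show ?thesis
    unfolding ultrametric_markovian_def
  proof (intro allI impI)
    fix I J :: "'a set" and f g :: "'a \<Rightarrow> complex"
    assume ball: "is_ball I" "is_ball J" and IJ: "I \<inter> J = {}"
      and f: "f \<in> test_functions" and g: "g \<in> test_functions"
      and supp: "{x. f x \<noteq> 0} \<subseteq> I" "{x. g x \<noteq> 0} \<subseteq> J"
      and zero: "(\<integral>x. f x \<partial>\<nu>) = 0 \<or> (\<integral>x. g x \<partial>\<nu>) = 0"
    show "indep_var borel (\<lambda>\<omega>. \<psi> \<omega> f) borel (\<lambda>\<omega>. \<psi> \<omega> g)"
    proof (rule gaussian_field_indep_var[OF gaussian f g mean])
      fix s1 s2 t1 t2
      let ?f = "real_combination s1 s2 f" and ?g = "real_combination t1 t2 g"
      have t: "?f \<in> test_functions" "?g \<in> test_functions"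
        using real_combination_real_test_function[OF f] real_combination_real_test_function[OF g]
        unfolding real_test_functions_def by auto
      have s: "{x. ?f x \<noteq> 0} \<subseteq> I" "{x. ?g x \<noteq> 0} \<subseteq> J"
        using supp by (auto simp: real_combination_def)
      from zero show "(\<integral>\<omega>. \<psi> \<omega> ?f * \<psi> \<omega> ?g \<partial>M) = 0"
      proof
        assume "(\<integral>x. f x \<partial>\<nu>) = 0"
        then show ?thesis
          using uncorrelated[OF _ ball IJ t(1) s(1) _ t(2) s(2)] real_combination_mean_zero[OF int[OF f]] by simp
      next
        assume "(\<integral>x. g x \<partial>\<nu>) = 0"
        \<comment> \<open>The bilinear correlation is symmetric, so exchanging the roles of
          \<open>I\<close> and \<open>J\<close> settles the case where \<open>g\<close> has mean
          zero.\<close>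
        then have "(\<integral>\<omega>. \<psi> \<omega> ?g * \<psi> \<omega> ?f \<partial>M) = 0"
          using uncorrelated[OF _ ball(2,1) _ t(2) s(2) _ t(1) s(1)] IJ real_combination_mean_zero[OF int[OF g]]
          by (simp add: Int_commute)
        then show ?thesis by (simp add: mult.commute)
      qed
    qed
  qed
qed

end
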